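(* Let $f(z)$ be an entire function of exponential type $\tau$ whose restriction $f(x)$ to the real line is absolutely integrable on $[0,\infty)$, i.e. $\int_0^\infty |f(x)|\,\mathrm{d}x<\infty$. Let $l$ be a non-negative integer and let $J_{2l}$ be the Bessel function of the first kind of order $2l$. Suppose that $f$ has the expansion $$f(z)=z^{2m+1}\sum_{j=0}^{\infty}a_j z^{2j},$$ where $a_0\neq 0$ and $m$ is an integer with $m+l\geq 0$. If $\lambda>\tau$, then $$\int_0^\infty f(x)\,J_{2l}(\lambda x)\,\mathrm{d}x=0\qquad\text{when } l<m+1,$$ and $$\int_0^\infty f(x)\,J_{2l}(\lambda x)\,\mathrm{d}x=\frac12\sum_{j=0}^{l-m-1}a_j\,\frac{(l+m+j)!}{(l-m-j-1)!}\left(\frac{2}{\lambda}\right)^{2m+2j+2}\qquad\text{when } l\geq m+1.$$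
   Context: An entire function $f:\mathbb{C}\to\mathbb{C}$ is said to be of exponential type $\tau$ (with $\tau\ge 0$ real) if for every (arbitrarily small) $\epsilon>0$ the inequality $|f(z)|\leq e^{(\tau+\epsilon)|z|}$ holds for all sufficiently large $|z|$ (with threshold depending on $\epsilon$). The parameter $\lambda$ is a positive real number. *)

theory Defs
  imports "HOL-Complex_Analysis.Complex_Analysis"
begin

definition entire_exponential_type :: "real \<Rightarrow> (complex \<Rightarrow> complex) \<Rightarrow> bool" where
  "entire_exponential_type \<tau> f \<longleftrightarrow>
     0 \<le> \<tau> \<and> f holomorphic_on UNIV \<and>
     (\<forall>\<epsilon>>0. \<forall>\<^sub>F z in at_infinity. norm (f z) \<le> exp ((\<tau> + \<epsilon>) * norm z))"

text \<open>Bessel function of the first kind of non-negative integer order, on the real line.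
  The power series converges everywhere.\<close>
definition bessel_J :: "nat \<Rightarrow> real \<Rightarrow> real" where
  "bessel_J n x = (\<Sum>k. (-1) ^ k / (fact k * fact (k + n)) * (x / 2) ^ (2 * k + n))"

end

theory Submission
  imports Defs "HOL-Probability.Sinc_Integral"
begin

text \<open>
  Let $G(s) = \int_0^\infty f(x) e^{isx}\,dx$, which is continuous on the closed upper half plane and
  holomorphic inside. Writing $J_{2l}(x) = \frac1\pi \int_{-\pi/2}^{\pi/2} \cos(2l\theta)
  e^{ix\sin\theta}\,d\theta$ turns the integral in question into $\frac1\pi \int_{-\pi/2}^{\pi/2}
  \cos(2l\theta)\, G(\lambda\sin\theta)\,d\theta$. If $f(z) = \sum_i b_i z^{2i-1}$, then termwise
  integration on the imaginary axis and the identity theorem give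
  $G(s) = \sum_i b_i (2i-1)!\, (-1/s^2)^i$ for $\mathrm{Im}\, s \ge 0$, $|s| > \tau$. In particular $G$ is even
  on the real axis outside $[-\tau,\tau]$; as $\lambda > \tau$, the integrand takes equal values at
  $\pm\pi/2 + iy$, so the path can be lifted to $\mathrm{Im}\, \theta = Y$ for every $Y > 0$. In terms of
  $q = e^{2i\theta}$ one has $-1/(\lambda\sin\theta)^2 = (4/\lambda^2)\, q/(1-q)^2$, and the lifted integral
  reads off the coefficient of $q^l$ in a power series in $q$.
\<close>

subsection \<open>An integral representation of the Bessel functions of even order\<close>

text \<open>On the real axis \<open>f\<close> is merely integrable, and integrating its odd powers
  against the Bessel function term by term gives divergent integrals. For
  \<open>s = \<i> * \<sigma>\<close> with \<sigma> > \<tau> the kernel is exponentially damped, so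
  the expansion of G is proved there and then carried over to the half plane. For real \<theta> the
  point lam sin \<theta> runs through [-\<tau>, \<tau>], where no expansion is at hand; this forces
  the lift to large Im \<theta>, where q is small. The half period [-pi/2, pi/2] is chosen because
  Im (sin \<theta>) = cos (Re \<theta>) sinh (Im \<theta>) keeps the sine in the closed upper half
  plane, the domain of G. The order is even so that cos (2 l \<theta>) has period pi. On the
  vertical sides |lam sin \<theta>| = lam cosh y >= lam > \<tau>; these values are real, so the
  expansion of G must hold up to the boundary. The sum is finite because q/(1-q)^2 begins with q, so
  only i <= l can contribute to q^l. The contribution of each i is a binomial coefficient whose
  denominator cancels (2i-1)!.\<close>

lemma has_integral_suminf_M_test:
  fixes u :: "nat \<Rightarrow> real \<Rightarrow> 'a::banach"
  assumes int: "\<And>n. (u n has_integral I n) {a..b}"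
    and cont: "\<And>n. continuous_on {a..b} (u n)"
    and le: "\<And>n t. t \<in> {a..b} \<Longrightarrow> norm (u n t) \<le> M n"
    and M: "summable M"
  shows "summable I" and "((\<lambda>t. \<Sum>n. u n t) has_integral suminf I) {a..b}"
proof -
  have "uniform_limit {a..b} (\<lambda>n t. \<Sum>i<n. u i t) (\<lambda>t. \<Sum>n. u n t) sequentially"
    by (rule Weierstrass_m_test[OF le M])
  moreover have "continuous_on {a..b} (\<lambda>t. \<Sum>i<n. u i t)" for n
    by (intro continuous_on_sum cont)
  ultimately obtain I' J where I': "\<And>n. ((\<lambda>t. \<Sum>i<n. u i t) has_integral I' n) {a..b}"
    and J: "((\<lambda>t. \<Sum>n. u n t) has_integral J) {a..b}" and lim: "I' \<longlonglongrightarrow> J"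
    by (rule uniform_limit_integral[where F=sequentially]) auto
  have "((\<lambda>t. \<Sum>i<n. u i t) has_integral (\<Sum>i<n. I i)) {a..b}" for n
    by (intro has_integral_sum int) auto
  with I' have "I' = (\<lambda>n. \<Sum>i<n. I i)"
    by (blast intro: has_integral_unique)
  with lim have "I sums J"
    by (simp add: sums_def)
  with J show "summable I" "((\<lambda>t. \<Sum>n. u n t) has_integral suminf I) {a..b}"
    by (auto simp: sums_iff)
qed

text \<open>Orthogonality of the exponentials with even frequencies: for \<open>n \<noteq> 0\<close>
  the antiderivative takes equal values at both endpoints, since the exponents differ by 2 pi n
  times the imaginary unit.\<close>

lemma has_integral_exp_period_pi:
  fixes n :: int
  shows "((\<lambda>x. exp (2 * \<i> * of_int n * of_real x)) has_integral (if n = 0 then of_real pi else 0)) {-pi/2..pi/2}"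
proof (cases "n = 0")
  case True
  then show ?thesis
    using has_integral_const_real[of "1::complex" "-pi/2" "pi/2"] by (simp add: scaleR_conv_of_real)
next
  case False
  let ?F = "\<lambda>x::real. exp (2 * \<i> * of_int n * of_real x) / (2 * \<i> * of_int n)"
  have "((\<lambda>x. exp (2 * \<i> * of_int n * of_real x)) has_integral (?F (pi/2) - ?F (-pi/2))) {-pi/2..pi/2}"
  proof (rule fundamental_theorem_of_calculus)
    show "- pi / 2 \<le> pi / 2" by simp
    show "(?F has_vector_derivative exp (2 * \<i> * of_int n * of_real x)) (at x within {-pi/2..pi/2})" for x
      using False
      by (auto intro!: derivative_eq_intros has_vector_derivative_real_field)
  qed
  moreover have "exp (2 * \<i> * of_int n * of_real (pi/2)) = exp (2 * \<i> * of_int n * of_real (-pi/2))"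
    unfolding exp_eq by (intro exI[of _ n]) (simp add: algebra_simps)
  ultimately show ?thesis
    using False by (simp add: diff_divide_distrib[symmetric])
qed

text \<open>Cauchy's coefficient formula on the circle of radius \<rho>, traversed once by
  \<open>\<rho> * exp (2 * \<i> * x)\<close>. Both signs of \<open>n\<close> are needed later
  because a cosine contributes a positive and a negative frequency.\<close>

lemma has_integral_eval_fps_circle:
  fixes F :: "complex fps" and n :: int
  assumes "0 < \<rho>" and "ereal \<rho> < fps_conv_radius F"
  shows "((\<lambda>x. exp (2 * \<i> * of_int n * of_real x) * eval_fps F (of_real \<rho> * exp (2 * \<i> * of_real x)))
      has_integral (if n \<le> 0 then of_real pi * of_real \<rho> ^ nat (-n) * fps_nth F (nat (-n)) else 0)) {-pi/2..pi/2}"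
proof -
  define u where "u k x = exp (2 * \<i> * of_int n * of_real x) *
    (fps_nth F k * (of_real \<rho> * exp (2 * \<i> * of_real x)) ^ k)" for k and x :: real
  define I where "I k = fps_nth F k * of_real \<rho> ^ k * (if n + int k = 0 then of_real pi else 0)" for k
  have u_eq: "u k = (\<lambda>x. fps_nth F k * of_real \<rho> ^ k * exp (2 * \<i> * of_int (n + int k) * of_real x))" for k
    by (rule ext) (simp add: u_def power_mult_distrib exp_of_nat_mult[symmetric] exp_add[symmetric] algebra_simps)
  have int: "(u k has_integral I k) {-pi/2..pi/2}" for k
    unfolding u_eq I_def by (intro has_integral_mult_right has_integral_exp_period_pi)
  have cont: "continuous_on {-pi/2..pi/2} (u k)" for k
    unfolding u_eq by (intro continuous_intros)
  have le: "norm (u k x) \<le> norm (fps_nth F k * of_real \<rho> ^ k)" for k x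
    using assms by (simp add: u_eq norm_mult norm_power)
  have sm: "summable (\<lambda>k. norm (fps_nth F k * complex_of_real \<rho> ^ k))"
    using assms by (intro abs_summable_in_conv_radius) (auto simp: fps_conv_radius_def)
  have sums: "(\<Sum>k. u k x) = exp (2 * \<i> * of_int n * of_real x) * eval_fps F (of_real \<rho> * exp (2 * \<i> * of_real x))" for x
    unfolding u_def eval_fps_def
    by (rule suminf_mult, rule summable_fps) (use assms in \<open>simp add: norm_mult\<close>)
  have "suminf I = (if n \<le> 0 then of_real pi * of_real \<rho> ^ nat (-n) * fps_nth F (nat (-n)) else 0)"
  proof (cases "n \<le> 0")
    case True
    have "I = (\<lambda>k. if k = nat (-n) then of_real pi * of_real \<rho> ^ k * fps_nth F k else 0)"
      using True by (auto simp: I_def fun_eq_iff)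
    then show ?thesis
      using True sums_single[of "nat (-n)" "\<lambda>k. of_real pi * of_real \<rho> ^ k * fps_nth F k"]
      by (simp add: sums_iff)
  next
    case False
    then have "I = (\<lambda>k. 0)"
      by (auto simp: I_def fun_eq_iff)
    then show ?thesis using False by simp
  qed
  with has_integral_suminf_M_test(2)[OF int cont le sm] show ?thesis
    by (simp add: sums)
qed

text \<open>Expand the power of sine by the binomial theorem into exponentials. The cosine supplies
  the frequencies \<open>l\<close> and \<open>- l\<close>, each with weight 1/2, so orthogonality
  keeps only j = p - l and j = p + l, which contribute equally by symmetry of the binomials. For l >
  p nothing survives, in agreement with the vanishing binomial.\<close>

lemma has_integral_cos_even_power_sin:
  "((\<lambda>x::real. cos (2 * real l * x) * sin x ^ (2 * p)) has_integral
     pi * (-1) ^ l * real ((2 * p) choose (p + l)) / 4 ^ p) {-pi/2..pi/2}"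
proof -
  define e where "e k x = exp (2 * \<i> * of_int k * complex_of_real x)" for k and x :: real
  define c where "c = (\<lambda>j. of_nat ((2*p) choose j) * (-1::complex) ^ j / (2 * (-4) ^ p))"
  have ee: "e j x * e k x = e (j + k) x" for j k x
    by (simp add: e_def exp_add[symmetric] algebra_simps)
  have A: "sin (complex_of_real x) ^ (2 * p) = (\<Sum>j\<le>2*p. of_nat ((2*p) choose j) * (-1::complex) ^ j / (-4) ^ p * e (int j - int p) x)" for x
  proof -
    have *: "exp (\<i> * complex_of_real x) ^ j * (- exp (- (\<i> * complex_of_real x))) ^ (2 * p - j) = (-1) ^ j * e (int j - int p) x"
      if "j \<le> 2 * p" for j
    proof -
      have "exp (\<i> * complex_of_real x) ^ j * exp (- (\<i> * complex_of_real x)) ^ (2 * p - j) = e (int j - int p) x"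
        using that by (simp add: e_def exp_of_nat_mult[symmetric] exp_add[symmetric] of_nat_diff algebra_simps)
      moreover have "(-1::complex) ^ (2 * p - j) = (-1) ^ j"
        using that by (auto simp: minus_one_power_iff)
      ultimately show ?thesis
        by (subst power_minus) (simp add: ac_simps)
    qed
    have "sin (complex_of_real x) ^ (2 * p) = (exp (\<i> * of_real x) + (- exp (- (\<i> * of_real x)))) ^ (2 * p) / (-4) ^ p"
    proof -
      have "(2 * \<i>) ^ (2 * p) = (-4) ^ p"
        by (simp add: power_mult power_mult_distrib)
      moreover have "sin (complex_of_real x) = (exp (\<i> * of_real x) + (- exp (- (\<i> * of_real x)))) / (2 * \<i>)"
        by (simp add: sin_exp_eq)
      ultimately show ?thesis
        by (simp only: power_divide)
    qed
    also have "(exp (\<i> * of_real x) + (- exp (- (\<i> * of_real x)))) ^ (2 * p) =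
        (\<Sum>j\<le>2*p. of_nat ((2*p) choose j) * exp (\<i> * of_real x) ^ j * (- exp (- (\<i> * of_real x))) ^ (2 * p - j))"
      by (rule binomial_ring)
    also have "\<dots> = (\<Sum>j\<le>2*p. of_nat ((2*p) choose j) * ((-1) ^ j * e (int j - int p) x))"
      by (rule sum.cong) (auto simp: * mult.assoc)
    finally show ?thesis
      by (simp add: sum_divide_distrib mult.assoc)
  qed
  have B: "cos (2 * of_nat l * complex_of_real x) = (e (int l) x + e (- int l) x) / 2" for x
    by (simp add: cos_exp_eq e_def mult_ac)
  have C: "(e (int l) x + e (- int l) x) / 2 * (of_nat ((2*p) choose j) * (-1) ^ j / (-4) ^ p * e (int j - int p) x) =
      c j * (e (int j - int p + int l) x + e (int j - int p - int l) x)" for j x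
  proof -
    have "e (int j - int p + int l) x = e (int j - int p) x * e (int l) x"
      "e (int j - int p - int l) x = e (int j - int p) x * e (- int l) x"
      by (simp_all add: ee)
    then show ?thesis
      by (simp add: c_def field_simps)
  qed
  have eq: "complex_of_real (cos (2 * real l * x) * sin x ^ (2 * p)) =
      (\<Sum>j\<le>2*p. c j * (e (int j - int p + int l) x + e (int j - int p - int l) x))" for x
  proof -
    have "complex_of_real (cos (2 * real l * x) * sin x ^ (2 * p)) =
        cos (2 * of_nat l * complex_of_real x) * sin (complex_of_real x) ^ (2 * p)"
      by (simp add: cos_of_real[symmetric] sin_of_real[symmetric])
    also have "\<dots> = (\<Sum>j\<le>2*p. c j * (e (int j - int p + int l) x + e (int j - int p - int l) x))"
      by (simp only: A B C sum_distrib_left)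
    finally show ?thesis .
  qed
  have "((\<lambda>x. \<Sum>j\<le>2*p. c j * (e (int j - int p + int l) x + e (int j - int p - int l) x)) has_integral
      (\<Sum>j\<le>2*p. c j * ((if int j - int p + int l = 0 then of_real pi else 0) +
         (if int j - int p - int l = 0 then of_real pi else 0)))) {-pi/2..pi/2}"
    unfolding e_def
    by (intro has_integral_sum has_integral_mult_right has_integral_add has_integral_exp_period_pi) auto
  also have "(\<Sum>j\<le>2*p. c j * ((if int j - int p + int l = 0 then of_real pi else 0) +
         (if int j - int p - int l = 0 then of_real pi else 0))) =
     (\<Sum>j\<le>2*p. if j + l = p then c j * of_real pi else 0) + (\<Sum>j\<le>2*p. if j = p + l then c j * of_real pi else 0)"
    by (subst sum.distrib[symmetric], rule sum.cong) (auto simp: algebra_simps)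
  also have "\<dots> = of_real (pi * (-1) ^ l * real ((2 * p) choose (p + l)) / 4 ^ p)"
  proof (cases "l \<le> p")
    case True
    have "(\<Sum>j\<le>2*p. if j + l = p then c j * of_real pi else 0) = (\<Sum>j\<le>2*p. if j = p - l then c j * of_real pi else 0)"
      using True by (intro sum.cong) auto
    moreover have "(2 * p) choose (p - l) = (2 * p) choose (p + l)"
      using True by (subst binomial_symmetric) (auto intro!: arg_cong2[of _ _ _ _ "(choose)"])
    moreover have "(-1::complex) ^ (p - l) = (-1) ^ (p + l)"
      using True by (auto simp: minus_one_power_iff)
    moreover have "(-4::complex) ^ p = (-1) ^ p * 4 ^ p"
      by (rule power_minus)
    ultimately show ?thesis
      using True by (simp add: c_def sum.delta power_add field_simps)
  next
    case False
    then have "(\<Sum>j\<le>2*p. if j + l = p then c j * of_real pi else 0) = 0"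
      by (intro sum.neutral) auto
    with False show ?thesis
      by (simp add: sum.delta)
  qed
  finally have "((\<lambda>x. complex_of_real (cos (2 * real l * x) * sin x ^ (2 * p))) has_integral
      of_real (pi * (-1) ^ l * real ((2 * p) choose (p + l)) / 4 ^ p)) {-pi/2..pi/2}"
    unfolding eq .
  from has_integral_Re[OF this] show ?thesis
    by (simp only: Re_complex_of_real)
qed

text \<open>Integrate the cosine series termwise. The factor (2p)! cancels against the numerator of
  the binomial, and the substitution p = k + l leaves exactly the Bessel series.\<close>

lemma has_integral_bessel_J_cos:
  "((\<lambda>t. cos (2 * real l * t) * cos (x * sin t)) has_integral pi * bessel_J (2 * l) x) {-pi/2..pi/2}"
proof -
  define u where "u p t = cos (2 * real l * t) * ((-1) ^ p / fact (2*p) * (x * sin t) ^ (2*p))" for p t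
  define I where "I p = (-1) ^ p / fact (2*p) * x ^ (2*p) * (pi * (-1) ^ l * real ((2*p) choose (p + l)) / 4 ^ p)" for p
  have u_eq: "u p = (\<lambda>t. (-1) ^ p / fact (2*p) * x ^ (2*p) * (cos (2 * real l * t) * sin t ^ (2*p)))" for p
    by (rule ext) (simp add: u_def power_mult_distrib)
  have int: "(u p has_integral I p) {-pi/2..pi/2}" for p
    unfolding u_eq I_def by (intro has_integral_mult_right has_integral_cos_even_power_sin)
  have cont: "continuous_on {-pi/2..pi/2} (u p)" for p
    unfolding u_eq by (intro continuous_intros)
  \<comment> \<open>Weakening (2p)! to p! turns the majorant into the exponential series at the
    square of \<open>x\<close>.\<close>
  have le: "norm (u p t) \<le> norm x ^ (2*p) / fact p" for p t
  proof -
    have "norm (u p t) = norm (cos (2 * real l * t)) * norm (sin t) ^ (2*p) * (norm x ^ (2*p) / fact (2*p))"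
      unfolding u_eq norm_mult norm_divide norm_power by (simp add: mult_ac)
    also have "\<dots> \<le> 1 * 1 * (norm x ^ (2*p) / fact p)"
      by (intro mult_mono divide_left_mono power_le_one fact_mono) auto
    finally show ?thesis by simp
  qed
  have "norm x ^ (2*p) / fact p = inverse (fact p) * ((norm x)\<^sup>2) ^ p" for p
    unfolding power_mult by (simp only: divide_inverse mult.commute)
  then have "summable (\<lambda>p. norm x ^ (2*p) / fact p)"
    using summable_exp[of "(norm x)\<^sup>2"] by presburger
  note sums = has_integral_suminf_M_test[OF int cont le this]
  have "(\<Sum>p. u p t) = cos (2 * real l * t) * cos (x * sin t)" for t
    unfolding u_def by (intro sums_unique[symmetric] sums_mult cos_paired)
  moreover have "suminf I = pi * bessel_J (2 * l) x"
  proof -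
    have I_shift: "I (k + l) = pi * ((-1) ^ k / (fact k * fact (k + 2 * l)) * (x / 2) ^ (2 * k + 2 * l))" for k
    proof -
      have *: "s / F * X * (pi * t * (F / (G * K)) / Q) = pi * ((s * t) / (K * G) * (X / Q))"
        if "F \<noteq> 0" for s t F X G K Q :: real
        using that by (simp add: mult_ac)
      have 1: "real ((2 * (k + l)) choose (k + l + l)) = fact (2 * (k + l)) / (fact (k + 2 * l) * fact k)"
        by (subst binomial_fact) (auto simp: mult_2 add.assoc)
      have 2: "(x / 2) ^ (2 * k + 2 * l) = x ^ (2 * (k + l)) / 4 ^ (k + l)"
        unfolding distrib_left[symmetric] power_divide power_mult[of 2] by simp
      have 3: "(-1::real) ^ k = (-1) ^ (k + l) * (-1) ^ l"
        by (auto simp: minus_one_power_iff)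
      show ?thesis
        unfolding I_def 1 2 3 by (rule *) simp
    qed
    \<comment> \<open>Here p + l > 2p, so the binomial coefficient is zero.\<close>
    have "(\<Sum>p<l. I p) = 0"
      by (intro sum.neutral) (auto simp: I_def)
    then have "suminf I = (\<Sum>k. I (k + l))"
      using suminf_split_initial_segment[OF sums(1), of l] by simp
    also have "\<dots> = pi * bessel_J (2 * l) x"
      unfolding I_shift bessel_J_def
    proof (rule suminf_mult)
      have "summable (\<lambda>k. inverse pi * I (k + l))"
        using sums(1) by (intro summable_mult summable_ignore_initial_segment)
      then show "summable (\<lambda>k. (-1) ^ k / (fact k * fact (k + 2 * l)) * (x / 2) ^ (2 * k + 2 * l))"
        unfolding I_shift by (simp add: mult.assoc[symmetric])
    qed
    finally show ?thesis .
  qed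
  ultimately show ?thesis
    using sums(2) by simp
qed

lemma has_integral_odd:
  fixes g :: "real \<Rightarrow> real"
  assumes "continuous_on {-a..a} g" and "\<And>x. g (-x) = - g x"
  shows "(g has_integral 0) {-a..a}"
proof -
  have "integral {-a..a} g = integral {-a..a} (\<lambda>x. g (-x))"
    using Henstock_Kurzweil_Integration.integral_reflect_real[of a "-a" g] by simp
  also have "\<dots> = - integral {-a..a} g"
    by (simp add: assms(2))
  finally have "integral {-a..a} g = 0"
    by simp
  with integrable_integral[OF integrable_continuous_real[OF assms(1)]] show ?thesis by simp
qed

text \<open>The added imaginary part has an odd integrand and integrates to zero. The exponential
  form is the one that matches the kernel of the half-line transform.\<close>

lemma has_integral_bessel_J:
  "((\<lambda>t. cos (2 * of_nat l * of_real t) * exp (\<i> * of_real (x * sin t))) has_integral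
     complex_of_real (pi * bessel_J (2 * l) x)) {-pi/2..pi/2}"
proof -
  have "((\<lambda>t. cos (2 * real l * t) * sin (x * sin t)) has_integral 0) {-(pi/2)..pi/2}"
    by (intro has_integral_odd continuous_intros) auto
  then have "((\<lambda>t. complex_of_real (cos (2 * real l * t) * cos (x * sin t)) +
      \<i> * complex_of_real (cos (2 * real l * t) * sin (x * sin t))) has_integral
      complex_of_real (pi * bessel_J (2 * l) x) + \<i> * complex_of_real 0) {-pi/2..pi/2}"
    by (intro has_integral_add has_integral_mult_right has_integral_of_real has_integral_bessel_J_cos) auto
  moreover have "complex_of_real (cos (2 * real l * t) * cos (x * sin t)) +
      \<i> * complex_of_real (cos (2 * real l * t) * sin (x * sin t)) =
      cos (2 * of_nat l * of_real t) * exp (\<i> * of_real (x * sin t))" for t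
    unfolding exp_Euler by (simp add: cos_of_real[symmetric] sin_of_real[symmetric] algebra_simps)
  ultimately show ?thesis by simp
qed

text \<open>The integral representation averages a function bounded by 1 over an interval of length
  pi. The bound is what makes the Bessel integral of an integrable function absolutely
  convergent.\<close>

lemma abs_bessel_J_even_le_one: "\<bar>bessel_J (2 * l) x\<bar> \<le> 1"
proof -
  have "norm (pi * bessel_J (2 * l) x) \<le> 1 * measure lborel {-pi/2..pi/2}"
  proof (rule has_integral_bound_real[OF _ _ has_integral_bessel_J_cos])
    show "norm (cos (2 * real l * t) * cos (x * sin t)) \<le> 1" for t
      using mult_mono[OF abs_cos_le_one[of "2 * real l * t"] abs_cos_le_one[of "x * sin t"]]
      by (simp add: abs_mult)
  qed auto
  then show ?thesis
    by (simp add: abs_mult)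
qed

lemma borel_measurable_bessel_J [measurable]: "bessel_J n \<in> borel_measurable borel"
  unfolding bessel_J_def by measurable

subsection \<open>The Fourier transform on the half-line\<close>

text \<open>This is the Laplace transform at \<open>- \<i> * s\<close>. With this sign the kernel
  has modulus at most 1 on the closed upper half plane, so integrability of \<open>g\<close>
  suffices up to the real axis.\<close>

definition half_fourier :: "(real \<Rightarrow> complex) \<Rightarrow> complex \<Rightarrow> complex" where
  "half_fourier g s = (LINT x:{0..}|lborel. g x * exp (\<i> * s * of_real x))"

lemma set_integrable_mult_norm_le_one:
  fixes g h :: "real \<Rightarrow> complex"
  assumes g: "set_integrable lborel A g" and [measurable]: "h \<in> borel_measurable borel" "A \<in> sets borel"
    and h: "\<And>x. x \<in> A \<Longrightarrow> norm (h x) \<le> 1"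
  shows "set_integrable lborel A (\<lambda>x. g x * h x)"
proof (rule set_integrable_bound[OF g])
  have "(\<lambda>x. indicator A x *\<^sub>R g x) \<in> borel_measurable lborel"
    using g by (auto simp: set_integrable_def)
  then have "(\<lambda>x. (indicator A x *\<^sub>R g x) * h x) \<in> borel_measurable lborel"
    by measurable
  then show "set_borel_measurable lborel A (\<lambda>x. g x * h x)"
    by (simp add: set_borel_measurable_def)
  show "AE x in lborel. x \<in> A \<longrightarrow> norm (g x * h x) \<le> norm (g x)"
    using h by (auto simp: norm_mult intro!: mult_left_le)
qed

text \<open>The truncation error is at most the tail of the integral of \<open>norm (g x)\<close>.
  This bound does not depend on \<open>h\<close>, which is the source of uniformity in
  \<open>s\<close> below.\<close>

lemma norm_set_integral_tail_le:
  fixes g h :: "real \<Rightarrow> complex"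
  assumes g: "set_integrable lborel {0..} g" and h: "h \<in> borel_measurable borel"
    and le: "\<And>x. 0 \<le> x \<Longrightarrow> norm (h x) \<le> 1" and b: "0 \<le> b"
  shows "norm ((LINT x:{0..b}|lborel. g x * h x) - (LINT x:{0..}|lborel. g x * h x))
           \<le> (LINT x:{0..}|lborel. norm (g x)) - (LINT x:{0..b}|lborel. norm (g x))"
proof -
  have un: "{0..} = {0..b} \<union> {b<..}" and dj: "{0..b} \<inter> {b<..} = {}"
    using b by auto
  have gh: "set_integrable lborel {0..} (\<lambda>x. g x * h x)"
    using le by (intro set_integrable_mult_norm_le_one[OF g h]) auto
  have split: "(LINT x:{0..}|lborel. k x) = (LINT x:{0..b}|lborel. k x) + (LINT x:{b<..}|lborel. k x)"
    if "set_integrable lborel {0..} k" for k :: "real \<Rightarrow> 'a::{banach, second_countable_topology}"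
    unfolding un
    by (rule set_integral_Un[OF dj]) (use b in \<open>auto intro!: set_integrable_subset[OF that]\<close>)
  have tail: "set_integrable lborel {b<..} (\<lambda>x. g x * h x)" "set_integrable lborel {b<..} g"
    by (rule set_integrable_subset[OF gh] set_integrable_subset[OF g]; use b in auto)+
  have "norm (LINT x:{b<..}|lborel. g x * h x) \<le> (LINT x:{b<..}|lborel. norm (g x * h x))"
    by (rule set_integral_norm_bound[OF tail(1)])
  also have "\<dots> \<le> (LINT x:{b<..}|lborel. norm (g x))"
  proof (rule set_integral_mono)
    show "norm (g x * h x) \<le> norm (g x)" if "x \<in> {b<..}" for x
      using le[of x] b that by (auto simp: norm_mult intro!: mult_left_le)
  qed (use tail in \<open>auto intro: set_integrable_norm\<close>)
  finally show ?thesis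
    using split[OF gh] split[OF set_integrable_norm[OF g]] by (simp add: norm_minus_commute)
qed

lemma uniform_limit_half_fourier:
  assumes g: "set_integrable lborel {0..} g" and cont: "continuous_on {0..} g"
  shows "uniform_limit {s. 0 \<le> Im s} (\<lambda>n s. integral {0..real n} (\<lambda>x. g x * exp (\<i> * s * of_real x)))
           (half_fourier g) sequentially"
proof (rule uniform_limitI)
  fix e :: real assume "0 < e"
  have "((\<lambda>b. LINT x:{0..b}|lborel. norm (g x)) \<longlongrightarrow> (LINT x:{0..}|lborel. norm (g x))) at_top"
    by (intro tendsto_set_lebesgue_integral_at_top set_integrable_norm g) auto
  then have "(\<lambda>n. LINT x:{0..real n}|lborel. norm (g x)) \<longlonglongrightarrow> (LINT x:{0..}|lborel. norm (g x))"
    by (rule filterlim_compose) (rule filterlim_real_sequentially)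
  then have "\<forall>\<^sub>F n in sequentially. dist (LINT x:{0..real n}|lborel. norm (g x)) (LINT x:{0..}|lborel. norm (g x)) < e"
    using \<open>0 < e\<close> by (rule tendstoD)
  then show "\<forall>\<^sub>F n in sequentially. \<forall>s\<in>{s. 0 \<le> Im s}.
      dist (integral {0..real n} (\<lambda>x. g x * exp (\<i> * s * of_real x))) (half_fourier g s) < e"
  proof (rule eventually_mono, intro ballI)
    fix n :: nat and s :: complex
    assume *: "dist (LINT x:{0..real n}|lborel. norm (g x)) (LINT x:{0..}|lborel. norm (g x)) < e"
      and s: "s \<in> {s. 0 \<le> Im s}"
    have "continuous_on {0..real n} (\<lambda>x. g x * exp (\<i> * s * of_real x))"
      by (intro continuous_intros continuous_on_subset[OF cont]) auto
    then have "integral {0..real n} (\<lambda>x. g x * exp (\<i> * s * of_real x)) =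
        (LINT x:{0..real n}|lborel. g x * exp (\<i> * s * of_real x))"
      by (intro set_borel_integral_eq_integral(2)[symmetric] borel_integrable_atLeastAtMost')
    with norm_set_integral_tail_le[OF g, of "\<lambda>x. exp (\<i> * s * of_real x)" "real n"]
    show "dist (integral {0..real n} (\<lambda>x. g x * exp (\<i> * s * of_real x))) (half_fourier g s) < e"
      using * s by (auto simp: half_fourier_def dist_norm)
  qed
qed

text \<open>The truncated transforms are entire, by differentiation under the integral over a
  compact interval. Uniform convergence on the closed half plane then transfers continuity up to the
  real axis, and holomorphy to the open half plane.\<close>

lemma
  assumes g: "set_integrable lborel {0..} g" and cont: "continuous_on {0..} g"
  shows continuous_on_half_fourier: "continuous_on {s. 0 \<le> Im s} (half_fourier g)"
    and holomorphic_on_half_fourier: "half_fourier g holomorphic_on {s. 0 < Im s}"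
proof -
  have hol: "(\<lambda>s. integral {0..real n} (\<lambda>x. g x * exp (\<i> * s * of_real x))) holomorphic_on UNIV" for n
    unfolding cbox_interval[symmetric]
  proof (rule leibniz_rule_holomorphic)
    show "((\<lambda>s. g x * exp (\<i> * s * of_real x)) has_field_derivative
        g x * (\<i> * of_real x * exp (\<i> * s * of_real x))) (at s within UNIV)" for s x
      by (auto intro!: derivative_eq_intros)
    show "(\<lambda>x. g x * exp (\<i> * s * of_real x)) integrable_on cbox 0 (real n)" for s
      by (intro integrable_continuous continuous_intros continuous_on_subset[OF cont]) auto
    show "continuous_on (UNIV \<times> cbox 0 (real n)) (\<lambda>(s, x). g x * (\<i> * of_real x * exp (\<i> * s * of_real x)))"
      unfolding split_beta
      by (intro continuous_intros continuous_on_compose2[OF cont continuous_on_snd]) auto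
  qed auto
  show "continuous_on {s. 0 \<le> Im s} (half_fourier g)"
    by (rule uniform_limit_theorem[OF always_eventually uniform_limit_half_fourier[OF g cont]])
       (auto intro: holomorphic_on_imp_continuous_on holomorphic_on_subset[OF hol])
  show "half_fourier g holomorphic_on {s. 0 < Im s}"
  proof (rule holomorphic_uniform_sequence)
    show op: "open {s. 0 < Im s}"
      by (rule open_halfspace_Im_gt)
    show "(\<lambda>s. integral {0..real n} (\<lambda>x. g x * exp (\<i> * s * of_real x))) holomorphic_on {s. 0 < Im s}" for n
      by (rule holomorphic_on_subset[OF hol]) auto
    fix s assume "s \<in> {s. 0 < Im s}"
    with op obtain d where "0 < d" "cball s d \<subseteq> {s. 0 < Im s}"
      by (meson open_contains_cball)
    moreover from this(2) have "cball s d \<subseteq> {s. 0 \<le> Im s}"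
      by force
    ultimately show "\<exists>d>0. cball s d \<subseteq> {s. 0 < Im s} \<and>
        uniform_limit (cball s d) (\<lambda>n s. integral {0..real n} (\<lambda>x. g x * exp (\<i> * s * of_real x)))
          (half_fourier g) sequentially"
      using uniform_limit_on_subset[OF uniform_limit_half_fourier[OF g cont]] by blast
  qed
qed

lemma set_integrable_mult_bessel_J:
  fixes g :: "real \<Rightarrow> complex"
  assumes "set_integrable lborel {0..} g"
  shows "set_integrable lborel {0..} (\<lambda>x. g x * of_real (bessel_J (2 * l) (lam * x)))"
  using abs_bessel_J_even_le_one by (intro set_integrable_mult_norm_le_one[OF assms]) auto

text \<open>Integrating the exponential kernel over \<open>t\<close> first produces the Bessel
  function. The interchange of integrals is done on rectangles, where joint continuity is enough;
  afterwards both sides pass to the limit, the left one by uniform convergence and the right one by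
  integrability.\<close>

lemma has_integral_cos_mult_half_fourier:
  assumes g: "set_integrable lborel {0..} g" and cont: "continuous_on {0..} g"
  shows "((\<lambda>t. cos (2 * of_nat l * of_real t) * half_fourier g (of_real lam * sin (of_real t))) has_integral
     of_real pi * (LINT x:{0..}|lborel. g x * of_real (bessel_J (2 * l) (lam * x)))) {-pi/2..pi/2}"
proof -
  define J where "J = (\<lambda>x. complex_of_real (bessel_J (2 * l) (lam * x)))"
  define c where "c = (\<lambda>t::real. cos (2 * of_nat l * complex_of_real t))"
  define F where "F n s = integral {0..real n} (\<lambda>x. g x * exp (\<i> * s * of_real x))" for n s
  have c_le: "norm (c t) \<le> 1" for t
  proof -
    have "c t = of_real (cos (2 * real l * t))"
      by (simp add: c_def cos_of_real[symmetric])
    then show ?thesis by (simp only: norm_of_real abs_cos_le_one)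
  qed
  have J: "((\<lambda>t. c t * exp (\<i> * (of_real lam * sin (of_real t)) * of_real x)) has_integral of_real pi * J x) {-pi/2..pi/2}" for x
    using has_integral_bessel_J[of l "lam * x"]
    by (simp add: c_def J_def sin_of_real[symmetric] mult_ac)
  have "uniform_limit {-pi/2..pi/2} (\<lambda>n t. c t * F n (of_real lam * sin (of_real t)))
     (\<lambda>t. c t * half_fourier g (of_real lam * sin (of_real t))) sequentially"
  proof (rule uniform_limitI)
    fix e :: real assume "0 < e"
    then show "\<forall>\<^sub>F n in sequentially. \<forall>t\<in>{-pi/2..pi/2}. dist (c t * F n (of_real lam * sin (of_real t)))
        (c t * half_fourier g (of_real lam * sin (of_real t))) < e"
    proof (rule eventually_mono[OF uniform_limitD[OF uniform_limit_half_fourier[OF g cont]]], intro ballI)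
      fix n t
      assume *: "\<forall>s\<in>{s. 0 \<le> Im s}. dist (integral {0..real n} (\<lambda>x. g x * exp (\<i> * s * of_real x))) (half_fourier g s) < e"
      let ?s = "complex_of_real lam * sin (of_real t)"
      have "?s \<in> {s. 0 \<le> Im s}"
        by (simp add: sin_of_real)
      with * have "dist (F n ?s) (half_fourier g ?s) < e"
        unfolding F_def by blast
      moreover have "dist (c t * F n ?s) (c t * half_fourier g ?s) \<le> dist (F n ?s) (half_fourier g ?s)"
        using mult_right_mono[OF c_le, of "norm (F n ?s - half_fourier g ?s)"]
        by (simp add: dist_norm norm_mult right_diff_distrib[symmetric])
      ultimately show "dist (c t * F n ?s) (c t * half_fourier g ?s) < e"
        by simp
    qed
  qed
  moreover have cont_xt: "continuous_on ({0..b} \<times> {-pi/2..pi/2}) (\<lambda>(x, t). g x * (c t * exp (\<i> * (of_real lam * sin (of_real t)) * of_real x)))" for b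
    unfolding split_beta c_def
    by (intro continuous_intros continuous_on_compose2[OF cont continuous_on_fst]) auto
  have inner: "integral {-pi/2..pi/2} (\<lambda>t. g x * (c t * exp (\<i> * (of_real lam * sin (of_real t)) * of_real x))) =
      of_real pi * (g x * J x)" for x
    using integral_unique[OF has_integral_mult_right[OF J, of "g x"]] by (rule trans) (rule mult.left_commute)
  have swap: "integral {-pi/2..pi/2} (\<lambda>t. c t * F n (of_real lam * sin (of_real t))) = of_real pi * (LINT x:{0..real n}|lborel. g x * J x)" for n
  proof -
    have "integral {-pi/2..pi/2} (\<lambda>t. c t * F n (of_real lam * sin (of_real t))) =
       integral {-pi/2..pi/2} (\<lambda>t. integral {0..real n} (\<lambda>x. g x * (c t * exp (\<i> * (of_real lam * sin (of_real t)) * of_real x))))"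
      unfolding F_def by (simp add: mult.left_commute[of "c _"] flip: integral_mult_right)
    also have "\<dots> = integral {0..real n} (\<lambda>x. integral {-pi/2..pi/2} (\<lambda>t. g x * (c t * exp (\<i> * (of_real lam * sin (of_real t)) * of_real x))))"
      using integral_swap_continuous[of 0 "-pi/2" "real n" "pi/2" "\<lambda>x t. g x * (c t * exp (\<i> * (of_real lam * sin (of_real t)) * of_real x))"]
        cont_xt[of "real n"] by (simp add: cbox_Pair_eq)
    also have "\<dots> = integral {0..real n} (\<lambda>x. of_real pi * (g x * J x))"
      by (simp only: inner)
    also have "\<dots> = of_real pi * (LINT x:{0..real n}|lborel. g x * J x)"
      using set_borel_integral_eq_integral(2)[OF set_integrable_subset[OF set_integrable_mult_bessel_J[OF g, of l lam], of "{0..real n}"]]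
      by (simp add: J_def)
    finally show ?thesis .
  qed
  have contF: "continuous_on {-pi/2..pi/2} (\<lambda>t. c t * F n (of_real lam * sin (of_real t)))" for n
  proof -
    have "continuous_on (cbox (-pi/2) (pi/2)) (\<lambda>t. integral (cbox 0 (real n)) (\<lambda>x. g x * (c t * exp (\<i> * (of_real lam * sin (of_real t)) * of_real x))))"
    proof (rule integral_continuous_on_param)
      show "continuous_on (cbox (-pi/2) (pi/2) \<times> cbox 0 (real n))
          (\<lambda>(t, x). g x * (c t * exp (\<i> * (of_real lam * sin (of_real t)) * of_real x)))"
        unfolding split_beta c_def
        by (intro continuous_intros continuous_on_compose2[OF cont continuous_on_snd]) auto
    qed
    then show ?thesis
      unfolding F_def by (simp add: mult.left_commute[of "c _"] flip: integral_mult_right)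
  qed
  ultimately obtain I K where I: "\<And>n. ((\<lambda>t. c t * F n (of_real lam * sin (of_real t))) has_integral I n) {-pi/2..pi/2}"
    and K: "((\<lambda>t. c t * half_fourier g (of_real lam * sin (of_real t))) has_integral K) {-pi/2..pi/2}"
    and lim: "I \<longlonglongrightarrow> K"
    by (rule uniform_limit_integral[where F=sequentially]) auto
  have "I n = of_real pi * (LINT x:{0..real n}|lborel. g x * J x)" for n
    using swap[of n] integral_unique[OF I[of n]] by simp
  moreover have "(\<lambda>n. of_real pi * (LINT x:{0..real n}|lborel. g x * J x)) \<longlonglongrightarrow> of_real pi * (LINT x:{0..}|lborel. g x * J x)"
  proof (rule tendsto_mult_left)
    have "((\<lambda>b. LINT x:{0..b}|lborel. g x * J x) \<longlongrightarrow> (LINT x:{0..}|lborel. g x * J x)) at_top"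
      unfolding J_def by (intro tendsto_set_lebesgue_integral_at_top set_integrable_mult_bessel_J g) auto
    then show "(\<lambda>n. LINT x:{0..real n}|lborel. g x * J x) \<longlonglongrightarrow> (LINT x:{0..}|lborel. g x * J x)"
      by (rule filterlim_compose) (rule filterlim_real_sequentially)
  qed
  ultimately have "K = of_real pi * (LINT x:{0..}|lborel. g x * J x)"
    using lim LIMSEQ_unique by (metis (no_types, lifting) ext)
  with K show ?thesis
    by (simp add: c_def J_def)
qed

subsection \<open>Shifting the path of integration in a half strip\<close>

lemma contour_integral_linepath_horizontal:
  assumes "a < b"
  shows "contour_integral (linepath (Complex a c) (Complex b c)) f = integral {a..b} (\<lambda>x. f (Complex x c))"
proof -
  have "contour_integral (linepath (Complex a c) (Complex b c)) f =
      contour_integral (linepath (of_real a) (of_real b)) (\<lambda>w. f (w + \<i> * of_real c))"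
  proof -
    have "Complex b c - Complex a c = of_real b - of_real a"
      by (simp add: complex_eq_iff)
    moreover have "linepath (Complex a c) (Complex b c) t = linepath (of_real a) (of_real b) t + \<i> * of_real c" for t
      by (simp add: linepath_def complex_eq_iff algebra_simps)
    ultimately show ?thesis
      by (simp add: contour_integral_integral)
  qed
  also have "\<dots> = integral {a..b} (\<lambda>x. f (of_real x + \<i> * of_real c))"
    using assms by (subst contour_integral_linepath_Reals_eq) auto
  finally show ?thesis
    by (simp add: Complex_eq)
qed

text \<open>Cauchy's theorem on the rectangle of height \<open>Y\<close>; by \<open>sides\<close>
  the two vertical integrals cancel. The form of Cauchy's theorem used asks only for continuity on
  the boundary, which matters because the half-line transform is not known to be holomorphic at real
  points.\<close>

lemma integral_shift_in_half_strip:
  fixes \<Phi> :: "complex \<Rightarrow> complex"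
  assumes cont: "continuous_on {z. a \<le> Re z \<and> Re z \<le> b \<and> 0 \<le> Im z} \<Phi>"
    and hol: "\<Phi> holomorphic_on {z. a < Re z \<and> Re z < b \<and> 0 < Im z}"
    and sides: "\<And>y. 0 \<le> y \<Longrightarrow> \<Phi> (Complex a y) = \<Phi> (Complex b y)"
    and "a < b" "0 < Y"
  shows "integral {a..b} (\<lambda>x. \<Phi> (of_real x)) = integral {a..b} (\<lambda>x. \<Phi> (Complex x Y))"
proof -
  define S where "S = cbox (Complex a 0) (Complex b Y)"
  define T where "T = {z. a < Re z \<and> Re z < b \<and> 0 < Im z}"
  have mem_S: "z \<in> S \<longleftrightarrow> a \<le> Re z \<and> Re z \<le> b \<and> 0 \<le> Im z \<and> Im z \<le> Y" for z
    by (auto simp: S_def in_cbox_complex_iff)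
  have cont_S: "continuous_on S \<Phi>"
    by (rule continuous_on_subset[OF cont]) (auto simp: mem_S)
  have "open T"
    unfolding T_def by (intro open_Collect_conj open_Collect_less continuous_intros)
  have corners: "Complex a 0 \<in> S" "Complex b 0 \<in> S" "Complex a Y \<in> S" "Complex b Y \<in> S"
    using assms by (auto simp: mem_S)
  have "convex S"
    by (simp add: S_def convex_box)
  then have seg: "closed_segment z w \<subseteq> S" if "z \<in> S" "w \<in> S" for z w
    using that by (rule closed_segment_subset[rotated 2])
  have ci: "\<Phi> contour_integrable_on linepath z w" if "z \<in> S" "w \<in> S" for z w
    by (intro contour_integrable_continuous_linepath continuous_on_subset[OF cont_S] seg that)
  let ?g = "linepath (Complex a 0) (Complex b 0) +++ linepath (Complex b 0) (Complex b Y) +++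
    linepath (Complex b Y) (Complex a Y) +++ linepath (Complex a Y) (Complex a 0)"
  have "(\<Phi> has_contour_integral 0) ?g"
  proof (rule Cauchy_theorem_convex[OF cont_S \<open>convex S\<close> finite.emptyI])
    fix z assume "z \<in> interior S - {}"
    then have "z \<in> T"
      by (auto simp: S_def T_def in_box_complex_iff)
    then show "\<Phi> field_differentiable at z"
      using hol \<open>open T\<close> by (auto simp: T_def intro: holomorphic_on_imp_differentiable_at)
  next
    show "path_image ?g \<subseteq> S"
      using seg corners by (simp add: path_image_join)
  qed (auto intro!: valid_path_join)
  then have "contour_integral ?g \<Phi> = 0"
    by (rule contour_integral_unique)
  then have "contour_integral (linepath (Complex a 0) (Complex b 0)) \<Phi> +
      (contour_integral (linepath (Complex b 0) (Complex b Y)) \<Phi> +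
      (contour_integral (linepath (Complex b Y) (Complex a Y)) \<Phi> +
       contour_integral (linepath (Complex a Y) (Complex a 0)) \<Phi>)) = 0"
    by (simp add: ci corners valid_path_join)
  moreover have "contour_integral (linepath (Complex a 0) (Complex b 0)) \<Phi> = integral {a..b} (\<lambda>x. \<Phi> (Complex x 0))"
    by (rule contour_integral_linepath_horizontal) fact
  moreover have "contour_integral (linepath (Complex a Y) (Complex b Y)) \<Phi> = integral {a..b} (\<lambda>x. \<Phi> (Complex x Y))"
    by (rule contour_integral_linepath_horizontal) fact
  moreover have "contour_integral (linepath (Complex b Y) (Complex a Y)) \<Phi> = - contour_integral (linepath (Complex a Y) (Complex b Y)) \<Phi>"
    by (intro contour_integral_reverse_linepath continuous_on_subset[OF cont_S] seg corners)
  moreover have "contour_integral (linepath (Complex a Y) (Complex a 0)) \<Phi> = - contour_integral (linepath (Complex a 0) (Complex a Y)) \<Phi>"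
    by (intro contour_integral_reverse_linepath continuous_on_subset[OF cont_S] seg corners)
  moreover have "contour_integral (linepath (Complex a 0) (Complex a Y)) \<Phi> = \<i> * integral {0..Y} (\<lambda>y. \<Phi> (Complex a y))"
    by (rule contour_integral_linepath_same_Re) (use assms in auto)
  moreover have "contour_integral (linepath (Complex b 0) (Complex b Y)) \<Phi> = \<i> * integral {0..Y} (\<lambda>y. \<Phi> (Complex b y))"
    by (rule contour_integral_linepath_same_Re) (use assms in auto)
  moreover have "integral {0..Y} (\<lambda>y. \<Phi> (Complex a y)) = integral {0..Y} (\<lambda>y. \<Phi> (Complex b y))"
    by (intro integral_cong sides) auto
  ultimately show ?thesis
    by (simp add: complex_of_real_def)
qed

subsection \<open>Taylor coefficients of functions of exponential type\<close>

lemma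
  fixes \<sigma> :: real
  assumes "0 < \<sigma>"
  shows set_integrable_power_exp: "set_integrable lborel {0..} (\<lambda>x. x ^ n * exp (- \<sigma> * x))"
    and set_integral_power_exp: "(LINT x:{0..}|lborel. x ^ n * exp (- \<sigma> * x)) = fact n / \<sigma> ^ (n + 1)"
proof -
  \<comment> \<open>The Gamma integral under the scaling by \<sigma>; the summand 0 keeps the shape
    of the affine substitution rule.\<close>
  have "has_bochner_integral lborel (\<lambda>x. (0 + \<sigma> * x) ^ n * exp (- (0 + \<sigma> * x)) * indicator {0..} (0 + \<sigma> * x)) (fact n /\<^sub>R \<bar>\<sigma>\<bar>)"
    by (subst lborel_has_bochner_integral_real_affine_iff[symmetric])
       (use assms in \<open>auto intro: has_bochner_integral_I0i_power_exp_m'\<close>)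
  then have "has_bochner_integral lborel
      (\<lambda>x. inverse (\<sigma> ^ n) * ((0 + \<sigma> * x) ^ n * exp (- (0 + \<sigma> * x)) * indicator {0..} (0 + \<sigma> * x)))
      (inverse (\<sigma> ^ n) * (fact n /\<^sub>R \<bar>\<sigma>\<bar>))"
    by (rule has_bochner_integral_mult_right)
  also have "(\<lambda>x. inverse (\<sigma> ^ n) * ((0 + \<sigma> * x) ^ n * exp (- (0 + \<sigma> * x)) * indicator {0..} (0 + \<sigma> * x))) =
      (\<lambda>x. indicator {0..} x *\<^sub>R (x ^ n * exp (- \<sigma> * x)))"
    using assms by (auto simp: fun_eq_iff indicator_def power_mult_distrib zero_le_mult_iff)
  also have "inverse (\<sigma> ^ n) * (fact n /\<^sub>R \<bar>\<sigma>\<bar>) = fact n / \<sigma> ^ (n + 1)"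
    using assms by (simp add: field_simps)
  finally show "set_integrable lborel {0..} (\<lambda>x. x ^ n * exp (- \<sigma> * x))"
    "(LINT x:{0..}|lborel. x ^ n * exp (- \<sigma> * x)) = fact n / \<sigma> ^ (n + 1)"
    by (auto simp: set_integrable_def set_lebesgue_integral_def has_bochner_integral_iff)
qed

text \<open>The threshold on \<open>norm z\<close> is traded for a constant: \<open>f\<close> is
  bounded on the remaining compact disc, and the exponential is at least 1 there because \<tau>' >
  \<tau> >= 0.\<close>

lemma exponential_type_imp_bound:
  fixes f :: "complex \<Rightarrow> complex"
  assumes "entire_exponential_type \<tau> f" "\<tau> < \<tau>'"
  obtains K where "0 < K" "\<And>z. norm (f z) \<le> K * exp (\<tau>' * norm z)"
proof -
  from assms have "\<forall>\<^sub>F z in at_infinity. norm (f z) \<le> exp ((\<tau> + (\<tau>' - \<tau>)) * norm z)"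
    unfolding entire_exponential_type_def by (meson diff_gt_0_iff_gt)
  then obtain R where R: "\<And>z. R \<le> norm z \<Longrightarrow> norm (f z) \<le> exp (\<tau>' * norm z)"
    by (auto simp: eventually_at_infinity)
  have "continuous_on (cball 0 R) f"
    using assms by (auto simp: entire_exponential_type_def intro: holomorphic_on_imp_continuous_on holomorphic_on_subset)
  then have "bounded (f ` cball 0 R)"
    by (intro compact_imp_bounded compact_continuous_image) auto
  then obtain B where B: "0 < B" "\<And>z. z \<in> cball 0 R \<Longrightarrow> norm (f z) \<le> B"
    by (auto simp: bounded_pos)
  show ?thesis
  proof (rule that)
    show "0 < 1 + B" using B by simp
    fix z :: complex
    have "0 \<le> \<tau>'"
      using assms by (auto simp: entire_exponential_type_def)
    then have "1 \<le> exp (\<tau>' * norm z)"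
      by simp
    show "norm (f z) \<le> (1 + B) * exp (\<tau>' * norm z)"
    proof (cases "R \<le> norm z")
      case True
      then show ?thesis using R[OF True] B by (simp add: distrib_right add_increasing2)
    next
      case False
      then have "norm (f z) \<le> B" using B by simp
      also have "\<dots> \<le> (1 + B) * 1" by simp
      also have "\<dots> \<le> (1 + B) * exp (\<tau>' * norm z)"
        using B \<open>1 \<le> exp (\<tau>' * norm z)\<close> by (intro mult_left_mono) auto
      finally show ?thesis .
    qed
  qed
qed

text \<open>Odd power series are written as $\sum_i b_i z^{2i-1}$ with $b_0 = 0$; at $i = 0$ the truncated
  exponent \<open>2 * i - 1\<close> is \<open>0\<close>, hence the assumption on \<open>b 0\<close>.\<close>

lemma odd_series_coeff_eq_deriv:
  fixes b :: "nat \<Rightarrow> complex"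
  assumes b0: "b 0 = 0" and f: "\<And>z. (\<lambda>i. b i * z ^ (2 * i - 1)) sums f z" and "0 < i"
  shows "b i = (deriv ^^ (2 * i - 1)) f 0 / fact (2 * i - 1)"
proof -
  have f': "(\<lambda>i. z * (b (Suc i) * (z\<^sup>2) ^ i)) sums f z" for z
  proof -
    have "(\<lambda>i. b (Suc i) * z ^ (2 * Suc i - 1)) sums f z"
      using f[of z] b0 by (subst sums_Suc_iff) simp
    also have "(\<lambda>i. b (Suc i) * z ^ (2 * Suc i - 1)) = (\<lambda>i. z * (b (Suc i) * (z\<^sup>2) ^ i))"
      by (simp add: fun_eq_iff power_mult)
    finally show ?thesis .
  qed
  have sm: "summable (\<lambda>i. b (Suc i) * w ^ i)" for w
  proof (cases "w = 0")
    case False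
    have "summable (\<lambda>i. csqrt w * (b (Suc i) * ((csqrt w)\<^sup>2) ^ i))"
      by (rule sums_summable[OF f'])
    with False show ?thesis by simp
  qed (simp add: summable_0_powser)
  define F where "F = fps_X * (Abs_fps (\<lambda>i. b (Suc i)) oo fps_X ^ 2)"
  have "((\<lambda>w. \<Sum>i. b (Suc i) * w ^ i) \<circ> (\<lambda>z. z ^ 2)) has_fps_expansion (Abs_fps (\<lambda>i. b (Suc i)) oo fps_X ^ 2)"
    by (intro has_fps_expansion_compose has_fps_expansionI always_eventually has_fps_expansion_fps_X_power allI)
       (auto intro: summable_sums sm)
  then have "(\<lambda>z. z * ((\<lambda>w. \<Sum>i. b (Suc i) * w ^ i) \<circ> (\<lambda>z. z ^ 2)) z) has_fps_expansion F"
    unfolding F_def by (intro has_fps_expansion_mult has_fps_expansion_fps_X)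
  also have "(\<lambda>z. z * ((\<lambda>w. \<Sum>i. b (Suc i) * w ^ i) \<circ> (\<lambda>z. z ^ 2)) z) = f"
    using f' sm by (auto simp: fun_eq_iff sums_iff suminf_mult)
  finally have "fps_nth F (2 * i - 1) = (deriv ^^ (2 * i - 1)) f 0 / fact (2 * i - 1)"
    by (rule fps_nth_fps_expansion)
  moreover obtain j where "i = Suc j"
    using \<open>0 < i\<close> by (cases i) auto
  ultimately show ?thesis
    by (simp add: F_def fps_nth_compose_X_power)
qed

text \<open>Cauchy's estimate on the circle of radius \<open>r\<close>. The radius stays free, since
  the inequality is later integrated over it and also applied at a multiple of a given
  point.\<close>

lemma odd_series_coeff_bound:
  fixes b :: "nat \<Rightarrow> complex"
  assumes b0: "b 0 = 0" and f: "\<And>z. (\<lambda>i. b i * z ^ (2 * i - 1)) sums f z"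
    and hol: "f holomorphic_on UNIV" and le: "\<And>z. norm (f z) \<le> K * exp (\<tau>' * norm z)"
    and "0 \<le> r" "0 \<le> K"
  shows "norm (b i) * r ^ (2 * i - 1) \<le> K * exp (\<tau>' * r)"
proof (cases "0 < r \<and> 0 < i")
  case True
  have "norm ((deriv ^^ (2 * i - 1)) f 0) \<le> fact (2 * i - 1) * (K * exp (\<tau>' * r)) / r ^ (2 * i - 1)"
  proof (rule Cauchy_inequality)
    show "norm (f x) \<le> K * exp (\<tau>' * r)" if "norm (0 - x) = r" for x
      using le[of x] that by simp
  qed (use True hol in \<open>auto intro: holomorphic_on_subset holomorphic_on_imp_continuous_on\<close>)
  moreover have "norm (b i) = norm ((deriv ^^ (2 * i - 1)) f 0) / fact (2 * i - 1)"
    using True by (simp add: odd_series_coeff_eq_deriv[OF b0 f] norm_divide)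
  moreover have "N / F * R \<le> B" if "N \<le> F * B / R" "0 < F" "0 < R" for N F B R :: real
    using that by (simp add: field_simps)
  ultimately show ?thesis
    using True by simp
next
  case False
  then have "norm (b i) * r ^ (2 * i - 1) = 0"
    using b0 \<open>0 \<le> r\<close> by (cases "i = 0") auto
  then show ?thesis
    using \<open>0 \<le> K\<close> by (simp only:) simp
qed

text \<open>Integrating the Cauchy estimate for radius \<open>r\<close> against \<open>exp (- \<sigma> * r)\<close> produces the
  factorial directly, without Stirling's formula.\<close>

lemma odd_series_coeff_fact_growth:
  fixes b :: "nat \<Rightarrow> complex"
  assumes b0: "b 0 = 0" and f: "\<And>z. (\<lambda>i. b i * z ^ (2 * i - 1)) sums f z"
    and type: "entire_exponential_type \<tau> f" and "\<tau> < \<sigma>"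
  obtains C where "\<And>i. norm (b i * fact (2 * i - 1)) \<le> C * \<sigma> ^ (2 * i)"
proof -
  \<comment> \<open>The midpoint leaves a gap on each side: \<tau> < \<tau>' yields the growth bound
    for \<open>f\<close>, and \<tau>' < \<sigma> makes the integral of exp (-(\<sigma> - \<tau>') r)
    finite.\<close>
  define \<tau>' where "\<tau>' = (\<tau> + \<sigma>) / 2"
  have *: "\<tau> < \<tau>'" "\<tau>' < \<sigma>" "0 < \<sigma>"
    using assms by (auto simp: \<tau>'_def entire_exponential_type_def)
  obtain K where K: "0 < K" "\<And>z. norm (f z) \<le> K * exp (\<tau>' * norm z)"
    using exponential_type_imp_bound[OF type *(1)] by blast
  have hol: "f holomorphic_on UNIV"
    using type by (simp add: entire_exponential_type_def)
  show ?thesis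
  proof (rule that)
    fix i
    show "norm (b i * fact (2 * i - 1)) \<le> K / (\<sigma> - \<tau>') * \<sigma> ^ (2 * i)"
    proof (cases "i = 0")
      case False
      have "(LINT x:{0..}|lborel. norm (b i) * (x ^ (2 * i - 1) * exp (- \<sigma> * x))) \<le>
          (LINT x:{0..}|lborel. K * (x ^ 0 * exp (- (\<sigma> - \<tau>') * x)))"
      proof (rule set_integral_mono)
        fix x :: real assume "x \<in> {0..}"
        then have "norm (b i) * x ^ (2 * i - 1) * exp (- \<sigma> * x) \<le> K * exp (\<tau>' * x) * exp (- \<sigma> * x)"
          using K by (intro mult_right_mono odd_series_coeff_bound[OF b0 f hol]) auto
        then show "norm (b i) * (x ^ (2 * i - 1) * exp (- \<sigma> * x)) \<le> K * (x ^ 0 * exp (- (\<sigma> - \<tau>') * x))"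
          by (simp add: mult_ac exp_add[symmetric] algebra_simps)
      qed (rule set_integrable_mult_right, rule set_integrable_power_exp, use * in simp)+
      then have "norm (b i) * (fact (2 * i - 1) / \<sigma> ^ (2 * i - 1 + 1)) \<le> K * (fact 0 / (\<sigma> - \<tau>') ^ (0 + 1))"
        using * unfolding set_integral_mult_right
        by (subst (asm) (1 2) set_integral_power_exp) auto
      moreover have "2 * i - 1 + 1 = 2 * i"
        using False by simp
      ultimately show ?thesis
        using * by (simp add: norm_mult field_simps)
    qed (use K * in \<open>simp add: b0\<close>)
  qed
qed

subsection \<open>The half-line transform of an odd function of exponential type\<close>

text \<open>On the imaginary axis the kernel is exp (- \<sigma> x), and the integral of x^(2i-1) exp
  (- \<sigma> x) is (2i-1)! / \<sigma>^(2i). The factorial growth bound makes the sum of the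
  integrals of absolute values converge, which justifies termwise integration.\<close>

lemma half_fourier_imaginary_axis:
  fixes b :: "nat \<Rightarrow> complex"
  assumes b0: "b 0 = 0" and f: "\<And>z. (\<lambda>i. b i * z ^ (2 * i - 1)) sums f z"
    and type: "entire_exponential_type \<tau> f" and "\<tau> < \<sigma>"
  shows "(\<lambda>i. b i * fact (2 * i - 1) * of_real (1 / \<sigma>\<^sup>2) ^ i) sums half_fourier (\<lambda>x. f (of_real x)) (\<i> * of_real \<sigma>)"
proof -
  \<comment> \<open>With the coefficient bound taken at this midpoint, the terms are dominated by a
    geometric series of ratio \<open>(\<sigma>' / \<sigma>)\<^sup>2\<close>.\<close>
  define \<sigma>' where "\<sigma>' = (\<tau> + \<sigma>) / 2"
  have \<sigma>: "\<tau> < \<sigma>'" "\<sigma>' < \<sigma>" "0 < \<sigma>'" "0 < \<sigma>"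
    using assms by (auto simp: \<sigma>'_def entire_exponential_type_def)
  obtain C where C: "\<And>i. norm (b i * fact (2 * i - 1)) \<le> C * \<sigma>' ^ (2 * i)"
    using odd_series_coeff_fact_growth[OF b0 f type \<sigma>(1)] by blast
  have sm: "summable (\<lambda>i. norm (b i * fact (2 * i - 1)) * (1 / \<sigma>\<^sup>2) ^ i)"
  proof (rule summable_comparison_test)
    show "\<exists>N. \<forall>i\<ge>N. norm (norm (b i * fact (2 * i - 1)) * (1 / \<sigma>\<^sup>2) ^ i) \<le> C * ((\<sigma>' / \<sigma>)\<^sup>2) ^ i"
    proof (intro exI allI impI)
      fix i
      have "norm (b i * fact (2 * i - 1)) * (1 / \<sigma>\<^sup>2) ^ i \<le> C * \<sigma>' ^ (2 * i) * (1 / \<sigma>\<^sup>2) ^ i"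
        using C \<sigma> by (intro mult_right_mono) auto
      also have "\<dots> = C * ((\<sigma>' / \<sigma>)\<^sup>2) ^ i"
        by (simp add: power_mult power_divide)
      finally show "norm (norm (b i * fact (2 * i - 1)) * (1 / \<sigma>\<^sup>2) ^ i) \<le> C * ((\<sigma>' / \<sigma>)\<^sup>2) ^ i"
        by simp
    qed
    show "summable (\<lambda>i. C * ((\<sigma>' / \<sigma>)\<^sup>2) ^ i)"
      using \<sigma> by (intro summable_mult summable_geometric) (simp add: power_less_one_iff)
  qed
  define u where "u i x = indicator {0..} x *\<^sub>R (b i * of_real (x ^ (2 * i - 1) * exp (- \<sigma> * x)))" for i and x :: real
  have int_pow: "integrable lborel (\<lambda>x. indicator {0..} x *\<^sub>R (x ^ (2 * i - 1) * exp (- \<sigma> * x)))" for i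
    using set_integrable_power_exp[OF \<sigma>(4)] by (simp add: set_integrable_def)
  have u_eq: "u i x = b i * of_real (indicator {0..} x *\<^sub>R (x ^ (2 * i - 1) * exp (- \<sigma> * x)))" for i x
    by (simp add: u_def indicator_def)
  have int: "integrable lborel (u i)" for i
    unfolding u_eq by (intro integrable_mult_right integrable_of_real int_pow)
  have LINT_pow: "(LINT x|lborel. indicator {0..} x *\<^sub>R (x ^ (2 * i - 1) * exp (- \<sigma> * x))) * norm (b i) =
     norm (b i * fact (2 * i - 1)) * (1 / \<sigma>\<^sup>2) ^ i" for i
  proof (cases "i = 0")
    case False
    then have "2 * i - 1 + 1 = 2 * i" by simp
    then show ?thesis
      using set_integral_power_exp[OF \<sigma>(4), of "2 * i - 1"]
      by (simp add: set_lebesgue_integral_def norm_mult power_mult power_divide)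
  qed (simp add: b0)
  have "summable (\<lambda>i. LINT x|lborel. norm (u i x))"
  proof -
    have norm_u: "norm (u i x) = indicator {0..} x *\<^sub>R (x ^ (2 * i - 1) * exp (- \<sigma> * x)) * norm (b i)" for i x
      by (auto simp: u_def norm_mult norm_power indicator_def)
    have "(LINT x|lborel. norm (u i x)) = norm (b i * fact (2 * i - 1)) * (1 / \<sigma>\<^sup>2) ^ i" for i
      unfolding norm_u LINT_pow[symmetric] by (rule integral_mult_left_zero)
    with sm show ?thesis by simp
  qed
  moreover have "AE x in lborel. summable (\<lambda>i. norm (u i x))"
  proof (intro AE_I2)
    fix x :: real
    obtain K where K: "0 < K" "\<And>z. norm (f z) \<le> K * exp (\<sigma> * norm z)"
      using exponential_type_imp_bound[OF type \<open>\<tau> < \<sigma>\<close>] by blast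
    have hol: "f holomorphic_on UNIV"
      using type by (simp add: entire_exponential_type_def)
    show "summable (\<lambda>i. norm (u i x))"
    proof (rule summable_comparison_test)
      \<comment> \<open>Cauchy's estimate at the doubled radius 2|x| gains a factor 2^-(2i-1). The
        index starts at 1 because the truncated exponent spoils the identity with powers of 1/4 at
        0.\<close>
      show "\<exists>N. \<forall>i\<ge>N. norm (norm (u i x)) \<le> K * exp (\<sigma> * (2 * \<bar>x\<bar>)) * (2 * (1 / 4) ^ i)"
      proof (intro exI allI impI)
        fix i :: nat assume "1 \<le> i"
        have "norm (u i x) = indicator {0..} x * (exp (- \<sigma> * x) * (norm (b i) * \<bar>x\<bar> ^ (2 * i - 1)))"
          by (auto simp: u_def norm_mult norm_power power_abs indicator_def)
        also have "\<dots> \<le> 1 * (norm (b i) * \<bar>x\<bar> ^ (2 * i - 1))"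
          using \<sigma> by (auto simp: indicator_def intro!: mult_left_le_one_le)
        also have "\<dots> = norm (b i) * (2 * \<bar>x\<bar>) ^ (2 * i - 1) * (1 / 2) ^ (2 * i - 1)"
          unfolding mult.assoc power_mult_distrib[symmetric] by simp
        also have "\<dots> \<le> K * exp (\<sigma> * (2 * \<bar>x\<bar>)) * (1 / 2) ^ (2 * i - 1)"
          using K by (intro mult_right_mono odd_series_coeff_bound[OF b0 f hol]) auto
        also have "(1 / 2 :: real) ^ (2 * i - 1) = 2 * (1 / 4) ^ i"
          using \<open>1 \<le> i\<close> by (simp add: power_diff power_mult power_divide)
        finally show "norm (norm (u i x)) \<le> K * exp (\<sigma> * (2 * \<bar>x\<bar>)) * (2 * (1 / 4) ^ i)"
          by simp
      qed
      show "summable (\<lambda>i. K * exp (\<sigma> * (2 * \<bar>x\<bar>)) * (2 * (1 / 4 :: real) ^ i))"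
        by (intro summable_mult summable_geometric) auto
    qed
  qed
  ultimately have "(\<lambda>i. LINT x|lborel. u i x) sums (LINT x|lborel. (\<Sum>i. u i x))"
    using int by (intro sums_integral)
  moreover have "(LINT x|lborel. u i x) = b i * fact (2 * i - 1) * of_real (1 / \<sigma>\<^sup>2) ^ i" for i
  proof (cases "i = 0")
    case False
    then have "2 * i - 1 + 1 = 2 * i" by simp
    then have "(LINT x|lborel. indicator {0..} x *\<^sub>R (x ^ (2 * i - 1) * exp (- \<sigma> * x))) = fact (2 * i - 1) * (1 / \<sigma>\<^sup>2) ^ i"
      using set_integral_power_exp[OF \<sigma>(4), of "2 * i - 1"]
      by (simp add: set_lebesgue_integral_def power_mult power_divide)
    then show ?thesis
      unfolding u_eq by (simp add: integral_complex_of_real del: real_scaleR_def)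
  qed (simp add: u_def b0)
  moreover have "(\<Sum>i. u i x) = indicator {0..} x *\<^sub>R (f (of_real x) * exp (\<i> * (\<i> * of_real \<sigma>) * of_real x))" for x
  proof -
    have "(\<lambda>i. (indicator {0..} x * exp (- \<sigma> * x)) *\<^sub>R (b i * of_real x ^ (2 * i - 1))) sums
        ((indicator {0..} x * exp (- \<sigma> * x)) *\<^sub>R f (of_real x))"
      by (intro sums_scaleR_right f)
    moreover have "(indicator {0..} x * exp (- \<sigma> * x)) *\<^sub>R (b i * of_real x ^ (2 * i - 1)) = u i x" for i
      by (simp add: u_def scaleR_conv_of_real mult_ac)
    moreover have "exp (\<i> * (\<i> * of_real \<sigma>) * of_real x) = complex_of_real (exp (- \<sigma> * x))"
      by (simp add: exp_of_real[symmetric] mult.assoc[symmetric])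
    ultimately show ?thesis
      by (simp add: sums_iff scaleR_conv_of_real mult_ac)
  qed
  ultimately show ?thesis
    by (simp add: half_fourier_def set_lebesgue_integral_def)
qed

text \<open>The identity theorem spreads the expansion from the imaginary axis over the open half
  plane outside a disc, and continuity extends it to real \<open>s\<close>. The real case is what
  the vertical sides of the contour require.\<close>

lemma half_fourier_eq_eval_fps:
  fixes b :: "nat \<Rightarrow> complex"
  assumes b0: "b 0 = 0" and f: "\<And>z. (\<lambda>i. b i * z ^ (2 * i - 1)) sums f z"
    and type: "entire_exponential_type \<tau> f"
    and integrable: "set_integrable lborel {0..} (\<lambda>x. f (of_real x))"
    and s: "0 \<le> Im s" "\<tau> < norm s"
  defines "F \<equiv> Abs_fps (\<lambda>i. b i * fact (2 * i - 1))"
  shows "half_fourier (\<lambda>x. f (of_real x)) s = eval_fps F (- 1 / s\<^sup>2)"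
proof -
  define G where "G = half_fourier (\<lambda>x. f (of_real x))"
  have "0 \<le> \<tau>" and hol: "f holomorphic_on UNIV"
    using type by (auto simp: entire_exponential_type_def)
  have cont: "continuous_on {0..} (\<lambda>x. f (of_real x))"
    by (rule continuous_on_compose2[OF holomorphic_on_imp_continuous_on[OF hol]]) (auto intro!: continuous_intros)
  note G = continuous_on_half_fourier[OF integrable cont, folded G_def]
    holomorphic_on_half_fourier[OF integrable cont, folded G_def]
  \<comment> \<open>An intermediate radius: \<open>F\<close> converges for arguments of modulus
    below \<open>1 / \<sigma>\<^sup>2\<close>, and \<open>- 1 / s\<^sup>2\<close> lies strictly
    inside.\<close>
  obtain \<sigma> where \<sigma>: "\<tau> < \<sigma>" "\<sigma> < norm s"
    using dense[OF s(2)] by blast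
  then have "0 < \<sigma>" using \<open>0 \<le> \<tau>\<close> by simp
  have radius: "ereal (1 / \<sigma>\<^sup>2) \<le> fps_conv_radius F"
  proof -
    have "summable (\<lambda>i. fps_nth F i * of_real (1 / \<sigma>\<^sup>2) ^ i)"
      unfolding F_def fps_nth_Abs_fps by (rule sums_summable[OF half_fourier_imaginary_axis[OF b0 f type \<sigma>(1)]])
    from conv_radius_geI[OF this] show ?thesis
      by (simp add: fps_conv_radius_def norm_divide norm_power)
  qed
  have norm_less: "- 1 / (exp w)\<^sup>2 \<in> eball 0 (fps_conv_radius F)" if "ln \<sigma> < Re w" for w
  proof -
    have "\<sigma> < exp (Re w)"
      using that \<open>0 < \<sigma>\<close> by (metis exp_less_mono exp_ln)
    then have "norm (- 1 / (exp w)\<^sup>2) < 1 / \<sigma>\<^sup>2"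
      using \<open>0 < \<sigma>\<close> by (simp add: norm_divide norm_power divide_strict_left_mono power_strict_mono)
    then have "ereal (norm (- 1 / (exp w)\<^sup>2)) < ereal (1 / \<sigma>\<^sup>2)"
      by simp
    also note radius
    finally show ?thesis
      by (simp add: in_eball_iff)
  qed
  \<comment> \<open>In the variable \<open>w = Ln s\<close> the half plane minus a disc becomes a convex half strip.\<close>
  define H where "H w = G (exp w) - eval_fps F (- 1 / (exp w)\<^sup>2)" for w
  define U where "U = {w. ln \<sigma> < Re w \<and> 0 < Im w \<and> Im w < pi}"
  \<comment> \<open>The image under the logarithm of the imaginary axis beyond \<sigma>, where the
    expansion is already proved.\<close>
  define L where "L = {w. ln \<sigma> < Re w \<and> Im w = pi / 2}"
  have H_hol: "H holomorphic_on U"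
    unfolding H_def
  proof (intro holomorphic_on_diff)
    have "(G \<circ> exp) holomorphic_on U"
      by (rule holomorphic_on_compose_gen[OF _ G(2)])
         (auto simp: U_def Im_exp intro!: mult_pos_pos sin_gt_zero holomorphic_intros)
    then show "(\<lambda>w. G (exp w)) holomorphic_on U"
      by (simp add: comp_def)
    have "(\<lambda>w. - 1 / (exp w)\<^sup>2) ` U \<subseteq> eball 0 (fps_conv_radius F)"
      by (rule image_subsetI, rule norm_less) (simp add: U_def)
    then have "(eval_fps F \<circ> (\<lambda>w. - 1 / (exp w)\<^sup>2)) holomorphic_on U"
      by (rule holomorphic_on_compose_gen[OF _ holomorphic_on_eval_fps[OF subset_refl], rotated])
         (auto intro!: holomorphic_intros)
    then show "(\<lambda>w. eval_fps F (- 1 / (exp w)\<^sup>2)) holomorphic_on U"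
      by (simp add: comp_def)
  qed
  have H_L: "H w = 0" if "w \<in> L" for w
  proof -
    define t where "t = exp (Re w)"
    have "\<sigma> < t"
      using that \<open>0 < \<sigma>\<close> unfolding t_def L_def by (metis (mono_tags, lifting) exp_less_mono exp_ln mem_Collect_eq)
    have Im_w: "Im w = pi / 2"
      using that by (simp add: L_def)
    have "exp w = \<i> * of_real t"
      unfolding complex_eq_iff Re_exp Im_exp Im_w by (simp add: t_def)
    moreover have "- 1 / (\<i> * complex_of_real t)\<^sup>2 = of_real (1 / t\<^sup>2)"
      by (simp add: power_mult_distrib)
    moreover have "G (\<i> * of_real t) = eval_fps F (of_real (1 / t\<^sup>2))"
      using half_fourier_imaginary_axis[OF b0 f type, of t] \<sigma> \<open>\<sigma> < t\<close>
      by (simp add: F_def G_def eval_fps_def sums_iff)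
    ultimately show ?thesis
      by (simp add: H_def)
  qed
  have H_U: "H w = 0" if "w \<in> U" for w
  proof (rule analytic_continuation[OF H_hol _ _ _ _ _ H_L that])
    show "open U"
      unfolding U_def by (intro open_Collect_conj open_Collect_less continuous_intros)
    have "convex U"
      unfolding U_def Collect_conj_eq
      by (intro convex_Int convex_halfspace_Re_gt convex_halfspace_Im_gt convex_halfspace_Im_lt)
    then show "connected U" by (rule convex_connected)
    show "L \<subseteq> U"
      by (auto simp: L_def U_def) (use pi_gt_zero in linarith)+
    show "Complex (ln \<sigma> + 1) (pi / 2) \<in> U"
      by (simp add: U_def)
    \<comment> \<open>A connected set with more than one point has no isolated points; this supplies
      the accumulation point for the identity theorem.\<close>
    have "convex L"
      unfolding L_def order_eq_iff Collect_conj_eq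
      by (intro convex_Int convex_halfspace_Re_gt convex_halfspace_Im_le convex_halfspace_Im_ge)
    moreover have "Complex (ln \<sigma> + 1) (pi / 2) \<in> L" "Complex (ln \<sigma> + 2) (pi / 2) \<in> L"
      by (auto simp: L_def)
    moreover have "L \<noteq> {x}" for x
      using calculation(2,3) by (auto simp: complex_eq_iff)
    ultimately show "Complex (ln \<sigma> + 1) (pi / 2) islimpt L"
      by (intro connected_imp_perfect convex_connected) auto
  qed
  define V where "V = {w. ln \<sigma> < Re w \<and> 0 \<le> Im w \<and> Im w \<le> pi}"
  have H_cont: "continuous_on V H"
    unfolding H_def
  proof (intro continuous_on_diff)
    show "continuous_on V (\<lambda>w. G (exp w))"
      by (rule continuous_on_compose2[OF G(1)])
         (auto simp: V_def Im_exp intro!: mult_nonneg_nonneg sin_ge_zero continuous_intros)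
    have "(\<lambda>w. - 1 / (exp w)\<^sup>2) ` V \<subseteq> eball 0 (fps_conv_radius F)"
      by (rule image_subsetI, rule norm_less) (simp add: V_def)
    then show "continuous_on V (\<lambda>w. eval_fps F (- 1 / (exp w)\<^sup>2))"
      by (rule continuous_on_compose2[OF holomorphic_on_imp_continuous_on[OF holomorphic_on_eval_fps[OF subset_refl]], rotated])
         (auto intro!: continuous_intros)
  qed
  have "s \<noteq> 0" using \<sigma> \<open>0 < \<sigma>\<close> by auto
  define w where "w = Ln s"
  have w: "exp w = s" "0 \<le> Im w" "Im w \<le> pi" "ln \<sigma> < Re w"
    using \<open>s \<noteq> 0\<close> s \<sigma> \<open>0 < \<sigma>\<close> Im_Ln_pos_le[of s] by (auto simp: w_def)
  \<comment> \<open>If \<open>s\<close> is real, then \<open>w\<close> lies on the edge of the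
    strip. The path moves from \<open>w\<close> to the middle line and is inside \<open>U\<close>
    for every t > 0, so \<open>H\<close> vanishes along it, and hence at \<open>w\<close> by
    continuity.\<close>
  define p where "p t = Complex (Re w) ((1 - t) * Im w + t * (pi / 2))" for t :: real
  have p_Im: "0 \<le> Im (p t)" "Im (p t) \<le> pi" if "0 \<le> t" "t \<le> 1" for t
  proof -
    show "0 \<le> Im (p t)" using w that by (simp add: p_def)
    have "(1 - t) * Im w \<le> (1 - t) * pi" "t * (pi / 2) \<le> t * pi"
      using w that by (auto intro!: mult_left_mono)
    moreover have "(1 - t) * pi + t * pi = pi"
      by (simp add: algebra_simps)
    ultimately show "Im (p t) \<le> pi"
      unfolding p_def complex.sel by linarith
  qed
  have p_V: "p t \<in> V" if "t \<in> {0..1}" for t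
    using p_Im[of t] that w by (auto simp: V_def p_def)
  have p_U: "p t \<in> U" if "0 < t" "t \<le> 1" for t
  proof -
    have "(1 - t) * Im w \<le> (1 - t) * pi" "t * (pi / 2) < t * pi" "0 \<le> (1 - t) * Im w" "0 < t * (pi / 2)"
      using w that by (auto intro!: mult_left_mono)
    moreover have "(1 - t) * pi + t * pi = pi"
      by (simp add: algebra_simps)
    ultimately show ?thesis
      using w(4) unfolding U_def p_def mem_Collect_eq complex.sel by (intro conjI) linarith+
  qed
  have "continuous_on {0..1} (\<lambda>t. H (p t))"
  proof (rule continuous_on_compose2[OF H_cont])
    show "continuous_on {0..1} p"
      unfolding p_def Complex_eq by (intro continuous_intros)
  qed (use p_V in auto)
  then have "((\<lambda>t. H (p t)) \<longlongrightarrow> H (p 0)) (at_right 0)"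
    by (auto simp: continuous_on_def at_within_Icc_at_right dest!: bspec[of _ _ 0])
  moreover have "((\<lambda>t. H (p t)) \<longlongrightarrow> 0) (at_right 0)"
  proof (rule tendsto_eventually)
    show "\<forall>\<^sub>F t in at_right 0. H (p t) = 0"
      unfolding eventually_at_right_field by (intro exI[of _ 1]) (auto intro!: H_U p_U)
  qed
  ultimately have "H (p 0) = 0"
    by (rule tendsto_unique[rotated]) simp
  moreover have "p 0 = w"
    by (simp add: p_def)
  ultimately show ?thesis
    using w(1) by (simp add: H_def G_def)
qed

subsection \<open>The Bessel transform\<close>

text \<open>The power equals c^i X^i (1 - X)^(-2i), so the coefficient is that of X^(l-i) in a
  negative binomial series.\<close>

lemma fps_nth_power_X_div_one_minus_X_squared:
  fixes c :: complex
  assumes "0 < i" "i \<le> l"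
  shows "fps_nth ((fps_const c * fps_X * inverse ((1 - fps_X) ^ 2)) ^ i) l = c ^ i * of_nat ((l + i - 1) choose (l - i))"
proof -
  have "(fps_const c * fps_X * inverse ((1 - fps_X) ^ 2)) ^ i =
      fps_const (c ^ i) * (fps_X ^ i * inverse ((1 - fps_const 1 * fps_X) ^ (2 * i)))"
    by (simp add: power_mult_distrib fps_inverse_power fps_const_power power_mult[symmetric] mult.assoc)
  also have "inverse ((1 - fps_const 1 * fps_X) ^ (2 * i)) = Abs_fps (\<lambda>k. of_nat ((2 * i + k - 1) choose k) * 1 ^ k :: complex)"
    using assms by (intro one_minus_const_fps_X_neg_power') auto
  moreover have "2 * i + (l - i) - 1 = l + i - 1"
    using assms by simp
  ultimately show ?thesis
    using assms by (simp add: fps_X_power_mult_nth)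
qed

lemma neg_inverse_sin_squared:
  fixes z :: complex
  defines "q \<equiv> exp (2 * \<i> * z)"
  shows "- 1 / (c * sin z)\<^sup>2 = 4 / c\<^sup>2 * q * inverse ((1 - q) ^ 2)"
proof -
  define e where "e = exp (\<i> * z)"
  have "e \<noteq> 0" and q: "q = e\<^sup>2" and "exp (- (\<i> * z)) = 1 / e"
    by (auto simp: e_def q_def exp_minus field_simps simp flip: exp_double)
  then have "sin z = (e\<^sup>2 - 1) / (2 * \<i> * e)"
    by (simp add: sin_exp_eq e_def[symmetric] field_simps power2_eq_square)
  then have "(sin z)\<^sup>2 = (q - 1)\<^sup>2 / (- 4 * q)"
    by (simp add: q power_mult_distrib power_divide)
  then have "(c * sin z)\<^sup>2 = c\<^sup>2 * ((1 - q)\<^sup>2 / (- 4 * q))"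
    by (simp only: power_mult_distrib power2_commute[of q 1])
  \<comment> \<open>In the degenerate cases both sides are 0 by the convention for division by zero,
    so zeros of the sine need no separate treatment.\<close>
  moreover have "- 1 / (C * (X / (- 4 * Q))) = 4 / C * Q * inverse X" for C X Q :: complex
    by (cases "C = 0 \<or> X = 0 \<or> Q = 0") (auto simp: field_simps)
  ultimately show ?thesis
    by (simp only:)
qed

text \<open>The term of modulus exp (Im z) dominates and the other has modulus at most 1. On the
  lifted path this gives |sin z| > 1, so the expansion of the transform applies there.\<close>

lemma norm_sin_ge:
  fixes z :: complex
  assumes "0 \<le> Im z"
  shows "(exp (Im z) - 1) / 2 \<le> norm (sin z)"
proof -
  have "exp (Im z) - exp (- Im z) \<le> norm (exp (\<i> * z) - exp (- (\<i> * z)))"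
    using norm_triangle_ineq2[of "exp (- (\<i> * z))" "exp (\<i> * z)"] by (simp add: norm_minus_commute)
  moreover have "exp (- Im z) \<le> 1"
    using assms by simp
  ultimately have "exp (Im z) - 1 \<le> norm (exp (\<i> * z) - exp (- (\<i> * z)))"
    by linarith
  then show ?thesis
    by (simp add: sin_exp_eq norm_divide norm_mult)
qed

text \<open>The even order enters here: a shift by pi changes the argument by \<open>l\<close> full
  periods.\<close>

lemma cos_even_mult_add_pi:
  "cos (2 * of_nat l * (z + of_real pi)) = cos (2 * of_nat l * (z::complex))"
  using cos.plus_of_nat[of "2 * of_nat l * z" l] by (simp add: algebra_simps)

lemma Im_sin_nonneg:
  assumes "- pi / 2 \<le> Re z" "Re z \<le> pi / 2" "0 \<le> Im z"
  shows "0 \<le> Im (sin z)"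
  using assms by (simp add: Im_sin cos_ge_zero)

lemma Im_sin_pos:
  assumes "- pi / 2 < Re z" "Re z < pi / 2" "0 < Im z"
  shows "0 < Im (sin z)"
  using assms by (simp add: Im_sin cos_gt_zero_pi)

lemma sin_half_pi_add_imaginary: "sin (Complex (pi / 2) y) = of_real (cosh y)"
  and sin_minus_half_pi_add_imaginary: "sin (Complex (- pi / 2) y) = - of_real (cosh y)"
  by (auto simp: complex_eq_iff Re_sin Im_sin cosh_def field_simps)

lemma set_integral_mult_bessel_J_odd_series:
  fixes b :: "nat \<Rightarrow> complex"
  assumes b0: "b 0 = 0" and f: "\<And>z. (\<lambda>i. b i * z ^ (2 * i - 1)) sums f z"
    and type: "entire_exponential_type \<tau> f"
    and integrable: "set_integrable lborel {0..} (\<lambda>x. f (of_real x))"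
    and lam: "0 < lam" "\<tau> < lam"
  shows "(LINT x:{0..}|lborel. f (of_real x) * of_real (bessel_J (2 * l) (lam * x))) =
    1 / 2 * (\<Sum>i=1..l. b i * (fact (l + i - 1) / fact (l - i)) * of_real ((2 / lam) ^ (2 * i)))"
proof -
  define F where "F = Abs_fps (\<lambda>i. b i * fact (2 * i - 1))"
  define G where "G = half_fourier (\<lambda>x. f (of_real x))"
  define \<Phi> where "\<Phi> z = cos (2 * of_nat l * z) * G (of_real lam * sin z)" for z
  define c :: complex where "c = 4 / (of_real lam)\<^sup>2"
  \<comment> \<open>The formal counterpart of -1 / (lam sin z)^2 in the variable q = exp (2 * \<i> *
    z).\<close>
  define P where "P = fps_const c * fps_X * inverse ((1 - fps_X) ^ 2)"
  have hol: "f holomorphic_on UNIV" and "0 \<le> \<tau>"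
    using type by (auto simp: entire_exponential_type_def)
  have cont: "continuous_on {0..} (\<lambda>x. f (of_real x))"
    by (rule continuous_on_compose2[OF holomorphic_on_imp_continuous_on[OF hol]]) (auto intro!: continuous_intros)
  note G = continuous_on_half_fourier[OF integrable cont, folded G_def]
    holomorphic_on_half_fourier[OF integrable cont, folded G_def]
  have G_eq: "G s = eval_fps F (- 1 / s\<^sup>2)" if "0 \<le> Im s" "\<tau> < norm s" for s
    unfolding G_def F_def by (rule half_fourier_eq_eval_fps[OF b0 f type integrable that])

  have radius: "0 < fps_conv_radius F"
  proof -
    have "summable (\<lambda>i. fps_nth F i * of_real (1 / lam\<^sup>2) ^ i)"
      unfolding F_def fps_nth_Abs_fps by (rule sums_summable[OF half_fourier_imaginary_axis[OF b0 f type lam(2)]])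
    from conv_radius_geI[OF this] have "ereal (1 / lam\<^sup>2) \<le> fps_conv_radius F"
      by (simp add: fps_conv_radius_def norm_divide norm_power)
    moreover have "0 < ereal (1 / lam\<^sup>2)"
      using lam by simp
    ultimately show ?thesis by (rule less_le_trans[rotated])
  qed
  have "(eval_fps F \<circ> (\<lambda>q. c * q * inverse ((1 - q) ^ 2))) has_fps_expansion (F oo P)"
    unfolding P_def
    by (intro has_fps_expansion_compose eval_fps_has_fps_expansion radius fps_expansion_intros) auto
  then have radius': "0 < fps_conv_radius (F oo P)"
    and ev: "\<forall>\<^sub>F q in nhds 0. eval_fps (F oo P) q = eval_fps F (c * q * inverse ((1 - q) ^ 2))"
    by (auto simp: has_fps_expansion_def)
  obtain d where d: "0 < d" "\<And>q. norm q < d \<Longrightarrow> eval_fps (F oo P) q = eval_fps F (c * q * inverse ((1 - q) ^ 2))"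
    using ev by (auto simp: eventually_nhds_metric)
  obtain r where r: "0 < ereal r" "ereal r < fps_conv_radius (F oo P)"
    using radius' ereal_dense2 by blast
  \<comment> \<open>The modulus of q on the lifted path. Being below \<open>d\<close> and
    \<open>r\<close> makes the composed series converge to the composed function; the bound 1/16
    forces exp Y >= 4 for the height with exp (-2 Y) = \<rho>, hence |sin z| >= 3/2 there.\<close>
  define \<rho> where "\<rho> = min (1 / 16) (min r (d / 2))"
  have \<rho>: "0 < \<rho>" "\<rho> < d" "\<rho> \<le> 1 / 16" "ereal \<rho> < fps_conv_radius (F oo P)"
  proof -
    show "0 < \<rho>" "\<rho> < d" "\<rho> \<le> 1 / 16" using d r by (auto simp: \<rho>_def)
    have "\<rho> \<le> r" by (simp add: \<rho>_def)
    then have "ereal \<rho> \<le> ereal r" by simp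
    then show "ereal \<rho> < fps_conv_radius (F oo P)" using r(2) by (rule le_less_trans)
  qed
  define Y where "Y = - ln \<rho> / 2"
  have exp_Y: "exp (- 2 * Y) = \<rho>"
    using \<rho> by (simp add: Y_def)
  have "4 \<le> exp Y"
  proof (rule power2_le_imp_le)
    have "(exp Y)\<^sup>2 = inverse \<rho>"
      unfolding exp_Y[symmetric] exp_minus[symmetric] by (simp flip: exp_double)
    also have "16 \<le> inverse \<rho>"
      using \<rho> by (simp add: field_simps)
    finally show "4\<^sup>2 \<le> (exp Y)\<^sup>2" by simp
  qed simp
  then have "1 < exp Y" by linarith
  then have "0 < Y" by simp

  have "of_real pi * (LINT x:{0..}|lborel. f (of_real x) * of_real (bessel_J (2 * l) (lam * x))) =
      integral {-pi/2..pi/2} (\<lambda>x. \<Phi> (of_real x))"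
    using integral_unique[OF has_integral_cos_mult_half_fourier[OF integrable cont, of l lam]] by (simp add: \<Phi>_def G_def)
  also have "\<dots> = integral {-pi/2..pi/2} (\<lambda>x. \<Phi> (Complex x Y))"
  proof (rule integral_shift_in_half_strip)
    show "continuous_on {z. - pi / 2 \<le> Re z \<and> Re z \<le> pi / 2 \<and> 0 \<le> Im z} \<Phi>"
      unfolding \<Phi>_def
      by (intro continuous_intros continuous_on_compose2[OF G(1)])
         (use lam in \<open>auto intro!: mult_nonneg_nonneg Im_sin_nonneg\<close>)
    have "(G \<circ> (\<lambda>z. of_real lam * sin z)) holomorphic_on {z. - pi / 2 < Re z \<and> Re z < pi / 2 \<and> 0 < Im z}"
      by (rule holomorphic_on_compose_gen[OF _ G(2)])
         (use lam in \<open>auto intro!: mult_pos_pos Im_sin_pos holomorphic_intros\<close>)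
    then show "\<Phi> holomorphic_on {z. - pi / 2 < Re z \<and> Re z < pi / 2 \<and> 0 < Im z}"
      unfolding \<Phi>_def by (intro holomorphic_intros) (simp add: comp_def)
    show "\<Phi> (Complex (- pi / 2) y) = \<Phi> (Complex (pi / 2) y)" for y
    proof -
      \<comment> \<open>\<open>G\<close> is even on the real axis outside \<open>[-\<tau>, \<tau>]\<close>, because there it is a function of \<open>s\<^sup>2\<close>.\<close>
      have "lam * 1 \<le> lam * cosh y"
        using lam cosh_real_ge_1 by (intro mult_left_mono) auto
      then have "\<tau> < lam * cosh y"
        using lam by linarith
      then have "\<tau> < norm (complex_of_real lam * of_real (cosh y))"
        using lam by (simp add: norm_mult)
      then have "G (of_real lam * of_real (cosh y)) = G (of_real lam * - of_real (cosh y))"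
        by (subst (1 2) G_eq) simp_all
      moreover have "Complex (pi / 2) y = Complex (- pi / 2) y + of_real pi"
        by (simp add: complex_eq_iff)
      then have "cos (2 * of_nat l * Complex (pi / 2) y) = cos (2 * of_nat l * Complex (- pi / 2) y)"
        by (simp only: cos_even_mult_add_pi)
      ultimately show ?thesis
        unfolding \<Phi>_def sin_half_pi_add_imaginary sin_minus_half_pi_add_imaginary by simp
    qed
  qed (use \<open>0 < Y\<close> in auto)
  \<comment> \<open>On the lifted path the cosine is (q^l + q^(-l)) / 2, and the transform is the
    composed power series in q.\<close>
  also have "\<dots> = integral {-pi/2..pi/2} (\<lambda>x.
      of_real (\<rho> ^ l) / 2 * (exp (2 * \<i> * of_int (int l) * of_real x) * eval_fps (F oo P) (of_real \<rho> * exp (2 * \<i> * of_real x))) +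
      1 / (2 * of_real (\<rho> ^ l)) * (exp (2 * \<i> * of_int (- int l) * of_real x) * eval_fps (F oo P) (of_real \<rho> * exp (2 * \<i> * of_real x))))"
  proof (rule integral_cong)
    fix x assume x: "x \<in> {-pi/2..pi/2}"
    define z where "z = Complex x Y"
    define q where "q = exp (2 * \<i> * z)"
    have q: "q = of_real \<rho> * exp (2 * \<i> * of_real x)"
      by (simp add: q_def z_def Complex_eq exp_Y[symmetric] exp_of_real[symmetric] exp_add[symmetric] algebra_simps)
    have "norm q < d"
      using \<rho> by (simp add: q norm_mult)
    have "lam * 1 < lam * norm (sin z)"
      using norm_sin_ge[of z] \<open>4 \<le> exp Y\<close> \<open>0 < Y\<close> lam by (intro mult_strict_left_mono) (auto simp: z_def)
    then have "\<tau> < lam * norm (sin z)"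
      using lam by linarith
    then have "\<tau> < norm (of_real lam * sin z)"
      using lam by (simp add: norm_mult)
    moreover have "0 \<le> Im (of_real lam * sin z)"
      using x lam \<open>0 < Y\<close> by (auto simp: z_def intro!: mult_nonneg_nonneg Im_sin_nonneg)
    ultimately have "G (of_real lam * sin z) = eval_fps F (- 1 / (of_real lam * sin z)\<^sup>2)"
      by (intro G_eq)
    also have "\<dots> = eval_fps (F oo P) q"
      unfolding neg_inverse_sin_squared c_def[symmetric] q_def[symmetric] using d(2)[OF \<open>norm q < d\<close>] by simp
    finally have 1: "G (of_real lam * sin z) = eval_fps (F oo P) q" .
    have "exp (\<i> * (2 * of_nat l * z)) = q ^ l" "exp (- (\<i> * (2 * of_nat l * z))) = inverse (q ^ l)"
      by (simp_all add: q_def exp_of_nat_mult[symmetric] exp_minus[symmetric] mult_ac)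
    then have 2: "cos (2 * of_nat l * z) = (q ^ l + inverse (q ^ l)) / 2"
      by (simp add: cos_exp_eq)
    have 3: "q ^ l = of_real (\<rho> ^ l) * exp (2 * \<i> * of_int (int l) * of_real x)"
      by (simp add: q power_mult_distrib exp_of_nat_mult[symmetric] mult_ac)
    have 4: "inverse (q ^ l) = 1 / of_real (\<rho> ^ l) * exp (2 * \<i> * of_int (- int l) * of_real x)"
      unfolding 3 by (simp add: exp_minus divide_inverse)
    show "\<Phi> (Complex x Y) =
      of_real (\<rho> ^ l) / 2 * (exp (2 * \<i> * of_int (int l) * of_real x) * eval_fps (F oo P) (of_real \<rho> * exp (2 * \<i> * of_real x))) +
      1 / (2 * of_real (\<rho> ^ l)) * (exp (2 * \<i> * of_int (- int l) * of_real x) * eval_fps (F oo P) (of_real \<rho> * exp (2 * \<i> * of_real x)))"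
      unfolding \<Phi>_def z_def[symmetric] 1 2 q[symmetric] 4 unfolding 3 by (simp add: algebra_simps add_divide_distrib)
  qed
  also have "\<dots> = of_real (\<rho> ^ l) / 2 * (if int l \<le> 0 then of_real pi * of_real \<rho> ^ nat (- int l) * fps_nth (F oo P) (nat (- int l)) else 0) +
      1 / (2 * of_real (\<rho> ^ l)) * (if - int l \<le> 0 then of_real pi * of_real \<rho> ^ nat (- (- int l)) * fps_nth (F oo P) (nat (- (- int l))) else 0)"
    by (intro integral_unique has_integral_add has_integral_mult_right has_integral_eval_fps_circle \<rho>)
  \<comment> \<open>The q^l part gives nothing: for l > 0 it would pick a coefficient of negative
    index, and for l = 0 the constant coefficient, which is 0 because
    \<open>b 0 = 0\<close>.\<close>
  also have "\<dots> = of_real pi * (1 / 2 * fps_nth (F oo P) l)"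
    using \<rho> by (auto simp: fps_compose_nth F_def b0)
  finally have "(LINT x:{0..}|lborel. f (of_real x) * of_real (bessel_J (2 * l) (lam * x))) = 1 / 2 * fps_nth (F oo P) l"
    by simp
  also have "fps_nth (F oo P) l = (\<Sum>i=1..l. fps_nth F i * fps_nth (P ^ i) l)"
    unfolding fps_compose_nth by (rule sum.mono_neutral_right) (auto simp: F_def b0 not_less_eq_eq)
  also have "\<dots> = (\<Sum>i=1..l. b i * (fact (l + i - 1) / fact (l - i)) * of_real ((2 / lam) ^ (2 * i)))"
  proof (rule sum.cong)
    fix i assume i: "i \<in> {1..l}"
    have "complex_of_real ((2 / lam) ^ (2 * i)) = c ^ i"
      by (simp add: c_def power_mult power_divide)
    moreover have idx: "l + i - 1 - (l - i) = 2 * i - 1"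
      using i by auto
    \<comment> \<open>The factor (2i-1)! in this denominator cancels the one in the coefficient of
      \<open>F\<close>.\<close>
    have "of_nat ((l + i - 1) choose (l - i)) = (fact (l + i - 1) / (fact (l - i) * fact (2 * i - 1)) :: complex)"
      using i idx by (subst binomial_fact) auto
    moreover have "fps_nth (P ^ i) l = c ^ i * of_nat ((l + i - 1) choose (l - i))"
      unfolding P_def using i by (intro fps_nth_power_X_div_one_minus_X_squared) auto
    ultimately show "fps_nth F i * fps_nth (P ^ i) l = b i * (fact (l + i - 1) / fact (l - i)) * of_real ((2 / lam) ^ (2 * i))"
      by (simp add: F_def)
  qed simp
  finally show ?thesis .
qed

text \<open>A negative \<open>m\<close> would give \<open>f\<close> a pole at 0: multiplying by the
  matching positive power of \<open>z\<close> yields the limit \<open>a 0\<close>, whereas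
  continuity of \<open>f\<close> makes that limit 0. In the theorem this excludes negative
  \<open>m\<close>.\<close>

lemma exponent_nonneg_if_continuous_at_0:
  fixes f :: "complex \<Rightarrow> complex" and a :: "nat \<Rightarrow> complex" and m :: int
  assumes cont: "isCont f 0"
    and sm: "\<And>z. summable (\<lambda>j. a j * z ^ (2 * j))"
    and f: "\<And>z. f z = z powi (2 * m + 1) * (\<Sum>j. a j * z ^ (2 * j))"
    and "a 0 \<noteq> 0"
  shows "0 \<le> m"
proof (rule ccontr)
  assume "\<not> 0 \<le> m"
  define k where "k = nat (- (2 * m + 1))"
  have k: "0 < k" "2 * m + 1 = - int k"
    using \<open>\<not> 0 \<le> m\<close> by (auto simp: k_def)
  have "summable (\<lambda>j. a j * w ^ j)" for w
    using sm[of "csqrt w"] by (simp add: power_mult)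
  then have "isCont (\<lambda>w. \<Sum>j. a j * w ^ j) 0"
    by (rule isCont_powser_converges_everywhere)
  then have "isCont (\<lambda>z. \<Sum>j. a j * (z\<^sup>2) ^ j) 0"
    by (intro isCont_o2[where g = "\<lambda>w. \<Sum>j. a j * w ^ j" and f = "\<lambda>z. z\<^sup>2"] continuous_intros) simp
  then have "((\<lambda>z. \<Sum>j. a j * z ^ (2 * j)) \<longlongrightarrow> a 0) (at 0)"
    by (simp add: isCont_def power_mult)
  moreover have lim: "((\<lambda>z. f z * z ^ k) \<longlongrightarrow> f 0 * 0 ^ k) (at 0)"
    using cont by (intro tendsto_intros) (simp add: isCont_def)
  have "\<forall>\<^sub>F z in at 0. f z * z ^ k = (\<Sum>j. a j * z ^ (2 * j))"
    by (rule eventually_mono[OF eventually_neq_at_within[of 0]])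
       (simp add: f k(2) power_int_minus)
  with lim have "((\<lambda>z. \<Sum>j. a j * z ^ (2 * j)) \<longlongrightarrow> f 0 * 0 ^ k) (at 0)"
    by (rule Lim_transform_eventually)
  ultimately have "a 0 = f 0 * 0 ^ k"
    by (intro tendsto_unique[OF trivial_limit_at])
  with k(1) \<open>a 0 \<noteq> 0\<close> show False by simp
qed

theorem theorem1:
  fixes f :: "complex \<Rightarrow> complex" and a :: "nat \<Rightarrow> complex"
    and \<tau> lam :: real and l :: nat and m :: int
  assumes "entire_exponential_type \<tau> f"
    and "set_integrable lborel {0..} (\<lambda>x::real. f (of_real x))"
    and "\<And>z. summable (\<lambda>j. a j * z ^ (2 * j))"
    and "\<And>z. f z = z powi (2 * m + 1) * (\<Sum>j. a j * z ^ (2 * j))"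
    and "a 0 \<noteq> 0"
    and "m + int l \<ge> 0"
    and "0 < lam" and "\<tau> < lam"
  shows "set_integrable lborel {0..}
           (\<lambda>x::real. f (of_real x) * of_real (bessel_J (2 * l) (lam * x))) \<and>
         (int l < m + 1 \<longrightarrow>
           (LINT x:{0..}|lborel. f (of_real x) * of_real (bessel_J (2 * l) (lam * x))) = 0) \<and>
         (int l \<ge> m + 1 \<longrightarrow>
           (LINT x:{0..}|lborel. f (of_real x) * of_real (bessel_J (2 * l) (lam * x))) =
             1 / 2 * (\<Sum>j = 0..nat (int l - m - 1).
               a j * (fact (nat (int l + m + int j)) / fact (nat (int l - m - int j - 1))) *
               of_real ((2 / lam) powi (2 * m + 2 * int j + 2))))"
proof -
  have "isCont f 0"
    using assms(1) by (auto simp: entire_exponential_type_def intro: holomorphic_on_imp_continuous_on continuous_on_interior)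
  then have "0 \<le> m"
    using assms(3-5) by (rule exponent_nonneg_if_continuous_at_0)
  define M where "M = nat m"
  have m: "m = int M"
    using \<open>0 \<le> m\<close> by (simp add: M_def)
  \<comment> \<open>The index is i = M + j + 1, so that 2i - 1 = 2M + 1 + 2j. In particular
    \<open>b 0 = 0\<close>, as the odd-series lemmas demand.\<close>
  define b where "b i = (if M < i then a (i - M - 1) else 0)" for i
  have sums: "(\<lambda>i. b i * z ^ (2 * i - 1)) sums f z" for z
  proof -
    have "(\<lambda>j. z ^ (2 * M + 1) * (a j * z ^ (2 * j))) sums (z ^ (2 * M + 1) * (\<Sum>j. a j * z ^ (2 * j)))"
      by (intro sums_mult summable_sums assms)
    also have "(\<lambda>j. z ^ (2 * M + 1) * (a j * z ^ (2 * j))) = (\<lambda>j. b (j + (M + 1)) * z ^ (2 * (j + (M + 1)) - 1))"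
      by (simp add: fun_eq_iff b_def mult_ac flip: power_add power_Suc)
    also have "z ^ (2 * M + 1) * (\<Sum>j. a j * z ^ (2 * j)) = f z - (\<Sum>i<M + 1. b i * z ^ (2 * i - 1))"
    proof -
      have "2 * m + 1 = int (2 * M + 1)"
        by (simp add: m)
      then have "z powi (2 * m + 1) = z ^ (2 * M + 1)"
        by (simp only: power_int_of_nat)
      then show ?thesis
        by (simp add: assms(4) b_def)
    qed
    finally show ?thesis
      by (subst (asm) sums_iff_shift')
  qed
  have I: "(LINT x:{0..}|lborel. f (of_real x) * of_real (bessel_J (2 * l) (lam * x))) =
      1 / 2 * (\<Sum>i=1..l. b i * (fact (l + i - 1) / fact (l - i)) * of_real ((2 / lam) ^ (2 * i)))"
    by (rule set_integral_mult_bessel_J_odd_series[OF _ sums assms(1,2,7,8)]) (simp add: b_def)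
  \<comment> \<open>Here l <= M, so the whole range lies below the first nonzero
    coefficient.\<close>
  have "(\<Sum>i=1..l. b i * (fact (l + i - 1) / fact (l - i)) * of_real ((2 / lam) ^ (2 * i))) = 0" if "int l < m + 1"
    using that by (intro sum.neutral) (auto simp: b_def m)
  moreover have "(\<Sum>i=1..l. b i * (fact (l + i - 1) / fact (l - i)) * of_real ((2 / lam) ^ (2 * i))) =
      (\<Sum>j = 0..nat (int l - m - 1). a j * (fact (nat (int l + m + int j)) / fact (nat (int l - m - int j - 1))) *
        of_real ((2 / lam) powi (2 * m + 2 * int j + 2)))" if "m + 1 \<le> int l"
  proof -
    have "(\<Sum>i=1..l. b i * (fact (l + i - 1) / fact (l - i)) * complex_of_real ((2 / lam) ^ (2 * i))) =
        (\<Sum>i=0 + (M + 1)..(l - M - 1) + (M + 1). b i * (fact (l + i - 1) / fact (l - i)) * of_real ((2 / lam) ^ (2 * i)))"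
      using that by (intro sum.mono_neutral_right) (auto simp: b_def m)
    also have "\<dots> = (\<Sum>j=0..l - M - 1. b (j + (M + 1)) * (fact (l + (j + (M + 1)) - 1) / fact (l - (j + (M + 1)))) *
        of_real ((2 / lam) ^ (2 * (j + (M + 1)))))"
      by (rule sum.shift_bounds_cl_nat_ivl)
    also have "\<dots> = (\<Sum>j = 0..nat (int l - m - 1). a j * (fact (nat (int l + m + int j)) / fact (nat (int l - m - int j - 1))) *
        of_real ((2 / lam) powi (2 * m + 2 * int j + 2)))"
    proof (rule sum.cong)
      fix j
      have "nat (int l + m + int j) = l + (j + (M + 1)) - 1" "nat (int l - m - int j - 1) = l - (j + (M + 1))"
        by (auto simp: m)
      moreover have "2 * m + 2 * int j + 2 = int (2 * (j + (M + 1)))"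
        by (simp add: m)
      then have "(2 / lam) powi (2 * m + 2 * int j + 2) = (2 / lam) ^ (2 * (j + (M + 1)))"
        by (simp only: power_int_of_nat)
      moreover have "b (j + (M + 1)) = a j"
        by (simp add: b_def)
      ultimately show "b (j + (M + 1)) * (fact (l + (j + (M + 1)) - 1) / fact (l - (j + (M + 1)))) *
          of_real ((2 / lam) ^ (2 * (j + (M + 1)))) =
          a j * (fact (nat (int l + m + int j)) / fact (nat (int l - m - int j - 1))) *
          of_real ((2 / lam) powi (2 * m + 2 * int j + 2))"
        by (simp only:)
    qed (auto simp: m)
    finally show ?thesis .
  qed
  ultimately show ?thesis
    unfolding I using set_integrable_mult_bessel_J[OF assms(2), of l lam] by auto
qed

end
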